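(* If $\varphi:\mathcal A\to M_m(\mathbb C)$ is a unital completely isometric linear map, then $n\le m$ and there are a unitary $U\in M_m(\mathbb C)$, a positive integer $\ell$, and a unital completely contractive linear map $\psi:\mathcal A\to M_{m-\ell n}(\mathbb C)$ such that $$\varphi(X)=U\big((X\otimes I_\ell)\oplus\psi(X)\big)U^*\quad\text{for every }X\in\mathcal A,$$ where $X\otimes I_\ell$ denotes the direct sum of $\ell$ copies of $X$.
   Context: $S$ denotes the $n\times n$ nilpotent Jordan block with ones on the superdiagonal and zeros elsewhere. $\mathcal A=\{f(S): f\text{ a complex polynomial}\}$ is the algebra of $n\times n$ upper-triangular Toeplitz matrices. Matrix algebras carry the operator norm induced by the Euclidean norm; unital means $\varphi(I)=I$. For a linear map $\varphi$ and $k\in\mathbb N$, $\varphi^{(k)}=\varphi\otimes\mathrm{id}_{M_k}$ applies $\varphi$ entrywise to $k\times k$ block matrices; $\varphi$ is completely isometric (resp. completely contractive) if every $\varphi^{(k)}$ is an isometry (resp. a contraction) for the operator norms. *)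

theory Defs
  imports "Jordan_Normal_Form.Jordan_Normal_Form" "Jordan_Normal_Form.Schur_Decomposition"
begin

definition poly_at_mat :: "complex poly \<Rightarrow> complex mat \<Rightarrow> complex mat" where
  "poly_at_mat f A = mat (dim_row A) (dim_row A)
     (\<lambda>(i,j). \<Sum>k\<le>degree f. coeff f k * (A ^\<^sub>m k) $$ (i,j))"

definition shift_mat :: "nat \<Rightarrow> complex mat" where
  "shift_mat n = jordan_block n 0"

text \<open>The algebra of n x n upper-triangular Toeplitz matrices, f(S) for f a complex polynomial.\<close>
definition toeplitz_alg :: "nat \<Rightarrow> complex mat set" where
  "toeplitz_alg n = {X. \<exists>f. X = poly_at_mat f (shift_mat n)}"

definition vec_norm2 :: "complex vec \<Rightarrow> real" where
  "vec_norm2 v = sqrt (\<Sum>i<dim_vec v. (cmod (v $ i))\<^sup>2)"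

definition op_norm :: "complex mat \<Rightarrow> real" where
  "op_norm A = Sup {vec_norm2 (A *\<^sub>v v) | v. v \<in> carrier_vec (dim_col A) \<and> vec_norm2 v \<le> 1}"

definition block_mat :: "nat \<Rightarrow> nat \<Rightarrow> nat \<Rightarrow> (nat \<Rightarrow> nat \<Rightarrow> complex mat) \<Rightarrow> complex mat" where
  "block_mat k p q F = mat (k * p) (k * q) (\<lambda>(i,j). F (i div p) (j div q) $$ (i mod p, j mod q))"

definition copies_mat :: "nat \<Rightarrow> complex mat \<Rightarrow> complex mat" where
  "copies_mat l X = block_mat l (dim_row X) (dim_col X)
     (\<lambda>a b. if a = b then X else 0\<^sub>m (dim_row X) (dim_col X))"

definition dsum_mat :: "complex mat \<Rightarrow> complex mat \<Rightarrow> complex mat" where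
  "dsum_mat A B = four_block_mat A (0\<^sub>m (dim_row A) (dim_col B)) (0\<^sub>m (dim_row B) (dim_col A)) B"

definition unitary_mat :: "complex mat \<Rightarrow> bool" where
  "unitary_mat U \<longleftrightarrow> U \<in> carrier_mat (dim_row U) (dim_row U) \<and>
     U * mat_adjoint U = 1\<^sub>m (dim_row U) \<and> mat_adjoint U * U = 1\<^sub>m (dim_row U)"

definition unital_linear_on :: "nat \<Rightarrow> nat \<Rightarrow> (complex mat \<Rightarrow> complex mat) \<Rightarrow> bool" where
  "unital_linear_on n m \<phi> \<longleftrightarrow>
     (\<forall>X\<in>toeplitz_alg n. \<phi> X \<in> carrier_mat m m) \<and>
     (\<forall>X\<in>toeplitz_alg n. \<forall>Y\<in>toeplitz_alg n. \<phi> (X + Y) = \<phi> X + \<phi> Y) \<and>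
     (\<forall>c. \<forall>X\<in>toeplitz_alg n. \<phi> (c \<cdot>\<^sub>m X) = c \<cdot>\<^sub>m \<phi> X) \<and>
     \<phi> (1\<^sub>m n) = 1\<^sub>m m"

definition completely_isometric_on :: "nat \<Rightarrow> nat \<Rightarrow> (complex mat \<Rightarrow> complex mat) \<Rightarrow> bool" where
  "completely_isometric_on n m \<phi> \<longleftrightarrow>
     (\<forall>k F. (\<forall>a<k. \<forall>b<k. F a b \<in> toeplitz_alg n) \<longrightarrow>
        op_norm (block_mat k m m (\<lambda>a b. \<phi> (F a b))) = op_norm (block_mat k n n F))"

definition completely_contractive_on :: "nat \<Rightarrow> nat \<Rightarrow> (complex mat \<Rightarrow> complex mat) \<Rightarrow> bool" where
  "completely_contractive_on n m \<phi> \<longleftrightarrow>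
     (\<forall>k F. (\<forall>a<k. \<forall>b<k. F a b \<in> toeplitz_alg n) \<longrightarrow>
        op_norm (block_mat k m m (\<lambda>a b. \<phi> (F a b))) \<le> op_norm (block_mat k n n F))"

end

theory Submission
  imports Defs "HOL-Analysis.L2_Norm"
begin

text \<open>
  Write \<open>T\<^sub>k = \<phi>(S\<^sup>k)\<close>, so that \<open>T\<^sub>k = 0\<close> for \<open>k \<ge> n\<close>. The block column with entries \<open>I, S, \<dots>, S\<^sup>n\<^sup>-\<^sup>1\<close> has
  norm \<open>\<surd>n\<close>, hence so has the column of the contractions \<open>T\<^sub>0, \<dots>, T\<^bsub>n-1\<^esub>\<close>; a norming unit vector \<open>x\<close> of the
  latter satisfies \<open>\<parallel>T\<^sub>k x\<parallel> = 1\<close> for all \<open>k < n\<close>. On the other hand a unital completely contractive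
  map preserves positivity of real parts, so for \<open>a \<le> b\<close> the \<open>3 \<times> 3\<close> block Toeplitz matrix built from
  \<open>T\<^sub>a\<close>, \<open>T\<^sub>b\<close>, \<open>T\<^bsub>b-a\<^esub>\<close> is positive. Its degeneracy on the pairs \<open>(x, - T\<^sub>j x)\<close> forces
  \<open>T\<^sub>a T\<^sub>j x = T\<^bsub>a+j\<^esub> x\<close> and \<open>T\<^sub>a\<^sup>* T\<^sub>j x = T\<^bsub>j-a\<^esub> x\<close> (\<open>0\<close> if \<open>a > j\<close>). Therefore
  \<open>T\<^bsub>n-1\<^esub> x, \<dots>, T\<^sub>0 x\<close> is an orthonormal basis of a subspace reducing every \<open>\<phi>(X)\<close>, on which
  \<open>\<phi>(X)\<close> acts as \<open>X\<close>. The compression of \<open>\<phi>\<close> to the orthogonal complement is \<open>\<psi>\<close>, so already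
  \<open>\<ell> = 1\<close> works.
\<close>

section \<open>Matrices on finite index sets and operator norms\<close>

text \<open>Vectors are functions on an arbitrary index set, so that block vectors live on a product
  \<open>I \<times> J\<close> and the analysis stays free of \<open>div\<close> and
  \<open>mod\<close>.\<close>

definition nsq :: "'a set \<Rightarrow> ('a \<Rightarrow> complex) \<Rightarrow> real" where
  "nsq I x = (\<Sum>i\<in>I. (cmod (x i))\<^sup>2)"

definition ip :: "'a set \<Rightarrow> ('a \<Rightarrow> complex) \<Rightarrow> ('a \<Rightarrow> complex) \<Rightarrow> complex" where
  "ip I x y = (\<Sum>i\<in>I. x i * cnj (y i))"

definition mv :: "'b set \<Rightarrow> ('a \<Rightarrow> 'b \<Rightarrow> complex) \<Rightarrow> ('b \<Rightarrow> complex) \<Rightarrow> 'a \<Rightarrow> complex" where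
  "mv J M x i = (\<Sum>j\<in>J. M i j * x j)"

definition adj :: "('a \<Rightarrow> 'b \<Rightarrow> complex) \<Rightarrow> 'b \<Rightarrow> 'a \<Rightarrow> complex" where
  "adj M i j = cnj (M j i)"

lemma nsq_nonneg [simp]: "0 \<le> nsq I x"
  by (simp add: nsq_def sum_nonneg)

lemma ip_self: "ip I x x = complex_of_real (nsq I x)"
  unfolding ip_def nsq_def of_real_sum complex_norm_square ..

lemma nsq_eq_0_iff: "finite I \<Longrightarrow> nsq I x = 0 \<longleftrightarrow> (\<forall>i\<in>I. x i = 0)"
  by (simp add: nsq_def sum_nonneg_eq_0_iff)

lemma ip_cnj: "ip I y x = cnj (ip I x y)"
  by (simp add: ip_def mult.commute)

lemma ip_add_left: "ip I (\<lambda>i. x i + y i) z = ip I x z + ip I y z"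
  and ip_add_right: "ip I z (\<lambda>i. x i + y i) = ip I z x + ip I z y"
  and ip_diff_left: "ip I (\<lambda>i. x i - y i) z = ip I x z - ip I y z"
  and ip_diff_right: "ip I z (\<lambda>i. x i - y i) = ip I z x - ip I z y"
  and ip_scale_left: "ip I (\<lambda>i. c * x i) z = c * ip I x z"
  and ip_scale_right: "ip I z (\<lambda>i. c * x i) = cnj c * ip I z x"
  and ip_minus_left: "ip I (\<lambda>i. - x i) z = - ip I x z"
  and ip_minus_right: "ip I z (\<lambda>i. - x i) = - ip I z x"
  by (simp_all add: ip_def algebra_simps sum.distrib sum_subtractf sum_distrib_left sum_negf)

lemma ip_cong: "(\<And>i. i \<in> I \<Longrightarrow> x i = x' i) \<Longrightarrow> (\<And>i. i \<in> I \<Longrightarrow> y i = y' i) \<Longrightarrow> ip I x y = ip I x' y'"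
  by (simp add: ip_def)

lemma nsq_cong: "(\<And>i. i \<in> I \<Longrightarrow> x i = x' i) \<Longrightarrow> nsq I x = nsq I x'"
  by (simp add: nsq_def)

lemma mv_cong: "(\<And>i. i \<in> I \<Longrightarrow> x i = x' i) \<Longrightarrow> mv I M x = mv I M x'"
  by (rule ext) (simp add: mv_def)

lemma nsq_conv_ip: "nsq I x = Re (ip I x x)"
  by (simp add: ip_self)

lemma nsq_scale: "nsq I (\<lambda>i. c * x i) = (cmod c)\<^sup>2 * nsq I x"
  by (simp add: nsq_def norm_mult power_mult_distrib sum_distrib_left)

lemma nsq_minus: "nsq I (\<lambda>i. - x i) = nsq I x"
  by (simp add: nsq_def)

lemma nsq_diff: "nsq I (\<lambda>i. x i - y i) = nsq I x - 2 * Re (ip I x y) + nsq I y"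
  by (simp add: nsq_conv_ip ip_diff_left ip_diff_right ip_cnj [of I y x])

lemma ip_mv_adj: "finite I \<Longrightarrow> finite J \<Longrightarrow> ip I (mv J M x) y = ip J x (mv I (adj M) y)"
  unfolding ip_def mv_def adj_def
  by (simp add: sum_distrib_left sum_distrib_right mult_ac sum.swap [of _ J])

text \<open>Cauchy-Schwarz in each row; the squared Frobenius norm serves as
  \<open>C\<close>.\<close>

lemma mv_bounded:
  assumes "finite I" "finite J"
  shows "\<exists>C\<ge>0. \<forall>x. nsq I (mv J M x) \<le> C * nsq J x"
proof -
  have cs: "(cmod (mv J M x i))\<^sup>2 \<le> (\<Sum>j\<in>J. (cmod (M i j))\<^sup>2) * nsq J x" for x i
  proof -
    have "cmod (mv J M x i) \<le> (\<Sum>j\<in>J. \<bar>cmod (M i j)\<bar> * \<bar>cmod (x j)\<bar>)"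
      unfolding mv_def by (rule sum_norm_le) (simp add: norm_mult)
    also have "\<dots> \<le> L2_set (\<lambda>j. cmod (M i j)) J * L2_set (\<lambda>j. cmod (x j)) J"
      by (rule L2_set_mult_ineq)
    finally have "(cmod (mv J M x i))\<^sup>2 \<le> (L2_set (\<lambda>j. cmod (M i j)) J * L2_set (\<lambda>j. cmod (x j)) J)\<^sup>2"
      by (rule power_mono) simp
    also have "\<dots> = (\<Sum>j\<in>J. (cmod (M i j))\<^sup>2) * nsq J x"
      by (simp add: power_mult_distrib L2_set_def nsq_def sum_nonneg)
    finally show ?thesis .
  qed
  show ?thesis
  proof (intro exI conjI allI)
    show "0 \<le> (\<Sum>i\<in>I. \<Sum>j\<in>J. (cmod (M i j))\<^sup>2)" by (simp add: sum_nonneg)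
    show "nsq I (mv J M x) \<le> (\<Sum>i\<in>I. \<Sum>j\<in>J. (cmod (M i j))\<^sup>2) * nsq J x" for x
    proof -
      have "nsq I (mv J M x) \<le> (\<Sum>i\<in>I. (\<Sum>j\<in>J. (cmod (M i j))\<^sup>2) * nsq J x)"
        unfolding nsq_def [of I] by (rule sum_mono) (rule cs)
      also have "\<dots> = (\<Sum>i\<in>I. \<Sum>j\<in>J. (cmod (M i j))\<^sup>2) * nsq J x"
        by (rule sum_distrib_right [symmetric])
      finally show ?thesis .
    qed
  qed
qed

text \<open>An operator has positive real part iff \<open>1 - t M\<close> has norm \<open>1 + O(t\<^sup>2)\<close> as \<open>t\<close> decreases
  to \<open>0\<close>; this is what makes complete contractivity imply positivity.\<close>

lemma accretive_imp_bound:
  assumes "finite I" and acc: "\<And>x. 0 \<le> Re (ip I (mv I M x) x)"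
  shows "\<exists>C\<ge>0. \<forall>t\<ge>0. \<forall>x. nsq I (\<lambda>i. x i - complex_of_real t * mv I M x i) \<le> (1 + t\<^sup>2 * C) * nsq I x"
proof -
  obtain C where C: "C \<ge> 0" "\<And>x. nsq I (mv I M x) \<le> C * nsq I x"
    using mv_bounded [OF assms(1) assms(1)] by blast
  have "nsq I (\<lambda>i. x i - complex_of_real t * mv I M x i) \<le> (1 + t\<^sup>2 * C) * nsq I x" if "t \<ge> 0" for t x
  proof -
    have "nsq I (\<lambda>i. x i - complex_of_real t * mv I M x i)
        = nsq I x - 2 * t * Re (ip I (mv I M x) x) + t\<^sup>2 * nsq I (mv I M x)"
      by (simp add: nsq_diff nsq_scale ip_scale_right ip_cnj [of I x])
    also have "\<dots> \<le> nsq I x + t\<^sup>2 * (C * nsq I x)"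
      using mult_left_mono [OF C(2) [of x], of "t\<^sup>2"] mult_nonneg_nonneg [OF that acc [of x]] by simp
    finally show ?thesis by (simp add: algebra_simps)
  qed
  with C(1) show ?thesis by blast
qed

lemma bound_imp_accretive:
  assumes bnd: "\<And>t. 0 \<le> t \<Longrightarrow> nsq I (\<lambda>i. x i - complex_of_real t * y i) \<le> (1 + t\<^sup>2 * C) * nsq I x"
  shows "0 \<le> Re (ip I y x)"
proof (rule ccontr)
  assume "\<not> ?thesis"
  then have neg: "Re (ip I y x) < 0" by simp
  define r where "r = - 2 * Re (ip I y x)"
  have r: "r > 0" using neg by (simp add: r_def)
  \<comment> \<open>The maximum keeps \<open>K\<close> positive. The choice of \<open>t\<close>
    below makes \<open>t * K = r / 2\<close>, too small for the quadratic term to absorb the linear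
    gain \<open>t * r\<close>.\<close>
  define K where "K = max 1 (C * nsq I x)"
  define t where "t = r / (2 * K)"
  have K: "K \<ge> 1" "C * nsq I x \<le> K" by (simp_all add: K_def)
  have t: "t > 0" using r K by (simp add: t_def)
  have "nsq I (\<lambda>i. x i - complex_of_real t * y i) = nsq I x + t * r + t\<^sup>2 * nsq I y"
    by (simp add: nsq_diff nsq_scale ip_scale_right ip_cnj [of I x] r_def)
  with bnd [of t] t have "t * r + t\<^sup>2 * nsq I y \<le> t\<^sup>2 * (C * nsq I x)"
    by (simp add: algebra_simps)
  moreover have "0 \<le> t\<^sup>2 * nsq I y" by simp
  moreover have "t\<^sup>2 * (C * nsq I x) \<le> t\<^sup>2 * K" by (rule mult_left_mono [OF K(2)]) simp
  ultimately have "t * r \<le> t * (t * K)" by (simp add: power2_eq_square mult.assoc)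
  then have "r \<le> t * K" using t by simp
  also have "\<dots> = r / 2" using K by (simp add: t_def)
  finally show False using r by simp
qed

section \<open>Operator norms of matrices and block matrices\<close>

lemma sum_lessThan_mult:
  "(\<Sum>i<k*p. f i) = (\<Sum>a<k. \<Sum>i<p. f (a * p + i))" for f :: "nat \<Rightarrow> 'a::comm_monoid_add"
proof -
  have "sum f {a*p..<a*p+p} = (\<Sum>i<p. f (a * p + i))" for a
    using sum.shift_bounds_nat_ivl [of f 0 "a*p" p] by (simp add: lessThan_atLeast0 add.commute)
  then show ?thesis
    using sum.nat_group [of f p k] by simp
qed

lemma block_index_less: "a * p + i < k * p" if "a < k" "i < p" for a i k p :: nat
proof -
  have "a * p + i < Suc a * p" using that by simp
  also have "\<dots> \<le> k * p" using that by (intro mult_right_mono) simp_all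
  finally show ?thesis .
qed

lemma vec_norm2_conv_nsq: "v \<in> carrier_vec d \<Longrightarrow> vec_norm2 v = sqrt (nsq {..<d} (\<lambda>i. v $ i))"
  by (simp add: vec_norm2_def nsq_def)

lemma mult_mat_vec_conv_mv:
  assumes "A \<in> carrier_mat p q" "v \<in> carrier_vec q" "i < p"
  shows "(A *\<^sub>v v) $ i = mv {..<q} (\<lambda>i j. A $$ (i,j)) (\<lambda>j. v $ j) i"
  using assms by (simp add: scalar_prod_def mv_def lessThan_atLeast0)

lemma vec_norm2_mult_conv_nsq:
  assumes "A \<in> carrier_mat p q" "v \<in> carrier_vec q"
  shows "vec_norm2 (A *\<^sub>v v) = sqrt (nsq {..<p} (mv {..<q} (\<lambda>i j. A $$ (i,j)) (\<lambda>j. v $ j)))"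
proof -
  have "A *\<^sub>v v \<in> carrier_vec p" using assms by simp
  then have "vec_norm2 (A *\<^sub>v v) = sqrt (nsq {..<p} (\<lambda>i. (A *\<^sub>v v) $ i))" by (rule vec_norm2_conv_nsq)
  also have "nsq {..<p} (\<lambda>i. (A *\<^sub>v v) $ i) = nsq {..<p} (mv {..<q} (\<lambda>i j. A $$ (i,j)) (\<lambda>j. v $ j))"
    by (rule nsq_cong) (simp add: mult_mat_vec_conv_mv [OF assms])
  finally show ?thesis .
qed

lemma vec_norm2_mult_le:
  assumes A: "A \<in> carrier_mat p q" and v: "v \<in> carrier_vec q" "vec_norm2 v \<le> 1" and r: "0 \<le> r"
    and bnd: "\<And>x. nsq {..<p} (mv {..<q} (\<lambda>i j. A $$ (i,j)) x) \<le> r\<^sup>2 * nsq {..<q} x"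
  shows "vec_norm2 (A *\<^sub>v v) \<le> r"
proof -
  have "nsq {..<q} (\<lambda>j. v $ j) \<le> 1" using v by (simp add: vec_norm2_conv_nsq)
  then have "r\<^sup>2 * nsq {..<q} (\<lambda>j. v $ j) \<le> r\<^sup>2 * 1" by (rule mult_left_mono) simp
  then have "nsq {..<p} (mv {..<q} (\<lambda>i j. A $$ (i,j)) (\<lambda>j. v $ j)) \<le> r\<^sup>2"
    using bnd by (metis mult.right_neutral order_trans)
  then show ?thesis using r by (simp add: vec_norm2_mult_conv_nsq [OF A v(1)] real_le_lsqrt)
qed

lemma op_norm_upper:
  assumes A: "A \<in> carrier_mat p q" and v: "v \<in> carrier_vec q" "vec_norm2 v \<le> 1"
  shows "vec_norm2 (A *\<^sub>v v) \<le> op_norm A"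
proof -
  obtain C where C: "C \<ge> 0" "\<And>x. nsq {..<p} (mv {..<q} (\<lambda>i j. A $$ (i,j)) x) \<le> C * nsq {..<q} x"
    using mv_bounded [of "{..<p}" "{..<q}" "\<lambda>i j. A $$ (i,j)"] by blast
  have "bdd_above {vec_norm2 (A *\<^sub>v v) | v. v \<in> carrier_vec (dim_col A) \<and> vec_norm2 v \<le> 1}"
    using vec_norm2_mult_le [OF A, of _ "sqrt C"] C A by (intro bdd_aboveI [of _ "sqrt C"]) auto
  moreover have "vec_norm2 (A *\<^sub>v v) \<in> {vec_norm2 (A *\<^sub>v v) | v. v \<in> carrier_vec (dim_col A) \<and> vec_norm2 v \<le> 1}"
    using A v by auto
  ultimately show ?thesis unfolding op_norm_def by (intro cSup_upper)
qed

lemma op_norm_nonneg: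
  assumes A: "A \<in> carrier_mat p q"
  shows "0 \<le> op_norm A"
proof -
  have "0 \<le> vec_norm2 (A *\<^sub>v 0\<^sub>v q)" by (simp add: vec_norm2_def sum_nonneg)
  also have "\<dots> \<le> op_norm A" by (rule op_norm_upper [OF A]) (simp_all add: vec_norm2_def)
  finally show ?thesis .
qed

text \<open>By homogeneity a bound on the unit ball is a bound for all vectors; upper bounds can
  then be handled as squared inequalities without the supremum.\<close>

lemma op_norm_le_iff:
  assumes A: "A \<in> carrier_mat p q" and c: "0 \<le> c"
  shows "op_norm A \<le> c \<longleftrightarrow> (\<forall>x. nsq {..<p} (mv {..<q} (\<lambda>i j. A $$ (i,j)) x) \<le> c\<^sup>2 * nsq {..<q} x)"
    (is "_ \<longleftrightarrow> ?B")
proof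
  assume B: ?B
  have "0\<^sub>v q \<in> carrier_vec q" "vec_norm2 (0\<^sub>v q) \<le> 1" by (simp_all add: vec_norm2_def)
  then have "{vec_norm2 (A *\<^sub>v v) | v. v \<in> carrier_vec (dim_col A) \<and> vec_norm2 v \<le> 1} \<noteq> {}"
    using A by blast
  then show "op_norm A \<le> c"
    unfolding op_norm_def using vec_norm2_mult_le [OF A _ _ c] B A by (intro cSup_least) auto
next
  assume op: "op_norm A \<le> c"
  let ?M = "\<lambda>i j. A $$ (i,j)"
  show ?B
  proof
    fix x
    let ?s = "nsq {..<q} x"
    show "nsq {..<p} (mv {..<q} ?M x) \<le> c\<^sup>2 * ?s"
    proof (cases "?s = 0")
      case True
      then have "\<forall>j<q. x j = 0" by (auto simp: nsq_eq_0_iff)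
      then show ?thesis by (simp add: nsq_def mv_def)
    next
      case False
      then have s: "?s > 0" using nsq_nonneg [of "{..<q}" x] by linarith
      define v where "v = vec q (\<lambda>j. complex_of_real (1 / sqrt ?s) * x j)"
      have v: "v \<in> carrier_vec q" by (simp add: v_def)
      have vx: "nsq {..<q} (\<lambda>j. v $ j) = nsq {..<q} (\<lambda>j. complex_of_real (1 / sqrt ?s) * x j)"
        by (rule nsq_cong) (simp add: v_def)
      have "vec_norm2 v \<le> 1"
        using s unfolding vec_norm2_conv_nsq [OF v] vx nsq_scale by (simp add: norm_divide power_divide)
      with op have "vec_norm2 (A *\<^sub>v v) \<le> c" using op_norm_upper [OF A v] by linarith
      then have "sqrt (nsq {..<p} (mv {..<q} ?M (\<lambda>j. v $ j))) \<le> c"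
        by (simp add: vec_norm2_mult_conv_nsq [OF A v])
      then have *: "nsq {..<p} (mv {..<q} ?M (\<lambda>j. v $ j)) \<le> c\<^sup>2" by (rule sqrt_le_D)
      have "nsq {..<p} (mv {..<q} ?M (\<lambda>j. v $ j))
          = nsq {..<p} (\<lambda>i. complex_of_real (1 / sqrt ?s) * mv {..<q} ?M x i)"
        by (rule nsq_cong) (simp add: mv_def v_def sum_distrib_left mult_ac)
      also have "\<dots> = nsq {..<p} (mv {..<q} ?M x) / ?s"
        using s unfolding nsq_scale by (simp add: norm_divide power_divide)
      finally show ?thesis using * s by (simp add: pos_divide_le_eq)
    qed
  qed
qed

text \<open>\<open>block_mat\<close> with its indices unflattened into pairs (block, position inside
  the block).\<close>

definition blk :: "(nat \<Rightarrow> nat \<Rightarrow> complex mat) \<Rightarrow> nat \<times> nat \<Rightarrow> nat \<times> nat \<Rightarrow> complex" where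
  "blk F r s = F (fst r) (fst s) $$ (snd r, snd s)"

lemma block_mat_carrier [simp]: "block_mat k p q F \<in> carrier_mat (k * p) (k * q)"
  by (simp add: block_mat_def)

lemma block_mat_index:
  assumes "a < k" "b < k" "i < p" "j < q"
  shows "block_mat k p q F $$ (a * p + i, b * q + j) = F a b $$ (i,j)"
  using assms by (simp add: block_mat_def block_index_less)

text \<open>Sending \<open>(a, i)\<close> to \<open>a * p + i\<close> matches pairs with flat
  indices; every vector on either side is a reindexed vector from the other, which gives both
  directions.\<close>

lemma op_norm_block_le_iff:
  assumes c: "0 \<le> c"
  shows "op_norm (block_mat k p q F) \<le> c \<longleftrightarrow>
    (\<forall>x. nsq ({..<k} \<times> {..<p}) (mv ({..<k} \<times> {..<q}) (blk F) x) \<le> c\<^sup>2 * nsq ({..<k} \<times> {..<q}) x)"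
    (is "_ \<longleftrightarrow> (\<forall>x. ?L x \<le> c\<^sup>2 * ?R x)")
proof -
  let ?A = "block_mat k p q F"
  let ?l = "\<lambda>y. nsq {..<k*p} (mv {..<k*q} (\<lambda>i j. ?A $$ (i,j)) y)"
  have r: "nsq {..<k*q} y = ?R (\<lambda>(b,j). y (b * q + j))" for y
    by (simp add: nsq_def sum_lessThan_mult sum.cartesian_product split_def)
  have l: "?l y = ?L (\<lambda>(b,j). y (b * q + j))" for y
    unfolding nsq_def mv_def sum_lessThan_mult sum.cartesian_product
    by (intro sum.cong refl) (auto simp: block_mat_index blk_def intro!: arg_cong [of _ _ "\<lambda>z. (cmod z)\<^sup>2"] sum.cong)
  have s: "?R x = nsq {..<k*q} (\<lambda>s. x (s div q, s mod q))"
    "?L x = ?l (\<lambda>s. x (s div q, s mod q))" for x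
    unfolding r l by (intro nsq_cong arg_cong [of _ _ "nsq _"] mv_cong; auto)+
  show ?thesis
    unfolding op_norm_le_iff [OF block_mat_carrier c]
  proof
    assume "\<forall>y. ?l y \<le> c\<^sup>2 * nsq {..<k*q} y"
    then show "\<forall>x. ?L x \<le> c\<^sup>2 * ?R x" unfolding s by blast
  next
    assume "\<forall>x. ?L x \<le> c\<^sup>2 * ?R x"
    then show "\<forall>y. ?l y \<le> c\<^sup>2 * nsq {..<k*q} y" unfolding l r by blast
  qed
qed

text \<open>Bolzano-Weierstrass for finitely many coordinates: thin out the sequence one coordinate
  at a time, each time to a monotone, hence convergent, subsequence. It supplies the compactness in
  \<open>sup_attained\<close>.\<close>

lemma finite_pointwise_bolzano:
  fixes f :: "nat \<Rightarrow> 'a \<Rightarrow> real"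
  assumes "finite I" "\<And>k i. i \<in> I \<Longrightarrow> \<bar>f k i\<bar> \<le> B"
  shows "\<exists>r. strict_mono (r :: nat \<Rightarrow> nat) \<and> (\<forall>i\<in>I. convergent (\<lambda>k. f (r k) i))"
  using assms
proof (induction I rule: finite_induct)
  case empty
  show ?case using strict_mono_id by blast
next
  case (insert i I)
  then obtain r where r: "strict_mono (r :: nat \<Rightarrow> nat)" "\<forall>j\<in>I. convergent (\<lambda>k. f (r k) j)" by auto
  obtain s where s: "strict_mono (s :: nat \<Rightarrow> nat)" "monoseq (\<lambda>k. f (r (s k)) i)"
    using seq_monosub [of "\<lambda>k. f (r k) i"] by blast
  have "Bseq (\<lambda>k. f (r (s k)) i)"
    by (rule BseqI' [of _ B]) (use insert.prems in auto)
  then have "convergent (\<lambda>k. f (r (s k)) i)" using s(2) by (rule Bseq_monoseq_convergent)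
  moreover have "convergent (\<lambda>k. f (r (s k)) j)" if "j \<in> I" for j
    using convergent_subseq_convergent [OF r(2) [rule_format, OF that] s(1)] by (simp add: o_def)
  ultimately show ?case
    using strict_mono_o [OF r(1) s(1)] by (intro exI [of _ "\<lambda>k. r (s k)"]) (auto simp: o_def)
qed

section \<open>The Toeplitz algebra and its images\<close>

text \<open>Only \<open>c 0, ..., c (n - 1)\<close> matter. Infinite sequences admit
  \<open>coeff f\<close> as an argument, whatever the degree of \<open>f\<close>.\<close>

definition toep :: "nat \<Rightarrow> (nat \<Rightarrow> complex) \<Rightarrow> complex mat" where
  "toep n c = mat n n (\<lambda>(i,j). if i \<le> j then c (j - i) else 0)"

definition shift_power :: "nat \<Rightarrow> nat \<Rightarrow> complex mat" where
  "shift_power n k = toep n (\<lambda>l. if l = k then 1 else 0)"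

lemma toep_carrier [simp]: "toep n c \<in> carrier_mat n n"
  by (simp add: toep_def)

lemma shift_power_index: "i < n \<Longrightarrow> j < n \<Longrightarrow> shift_power n k $$ (i,j) = (if j = i + k then 1 else 0)"
  by (auto simp: shift_power_def toep_def)

lemma shift_mat_power_index:
  assumes "i < n" "j < n"
  shows "(shift_mat n ^\<^sub>m k) $$ (i,j) = (if j = i + k then 1 else 0)"
proof -
  have "(shift_mat n ^\<^sub>m k) $$ (i,j) = (if i \<le> j then of_nat (k choose (j - i)) * 0 ^ (k + i - j) else 0)"
    using assms by (simp add: shift_mat_def jordan_block_pow)
  \<comment> \<open>For \<open>j - i < k\<close> the power of \<open>0\<close> vanishes; for
    \<open>j - i > k\<close> truncated subtraction turns it into \<open>1\<close>, but the binomial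
    coefficient vanishes.\<close>
  also have "\<dots> = (if j = i + k then 1 else 0)"
    by (auto simp: power_0_left not_le binomial_eq_0)
  finally show ?thesis .
qed

lemma poly_at_shift: "poly_at_mat f (shift_mat n) = toep n (coeff f)"
proof (rule eq_matI)
  fix i j assume "i < dim_row (toep n (coeff f))" "j < dim_col (toep n (coeff f))"
  then have ij: "i < n" "j < n" by (simp_all add: toep_def)
  have "poly_at_mat f (shift_mat n) $$ (i,j) = (\<Sum>k\<le>degree f. coeff f k * (shift_mat n ^\<^sub>m k) $$ (i,j))"
    using ij by (simp add: poly_at_mat_def shift_mat_def)
  also have "\<dots> = (\<Sum>k\<le>degree f. if k = j - i then (if i \<le> j then coeff f k else 0) else 0)"
    using ij by (intro sum.cong refl) (auto simp: shift_mat_power_index)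
  also have "\<dots> = (if i \<le> j then coeff f (j - i) else 0)"
    by (simp add: coeff_eq_0)
  finally show "poly_at_mat f (shift_mat n) $$ (i,j) = toep n (coeff f) $$ (i,j)"
    using ij by (simp add: toep_def)
qed (simp_all add: poly_at_mat_def shift_mat_def toep_def)

text \<open>Cutting a sequence off after \<open>n\<close> terms leaves \<open>toep n\<close>
  unchanged and yields the coefficients of a polynomial.\<close>

lemma toeplitz_alg_eq: "toeplitz_alg n = range (toep n)"
proof
  show "toeplitz_alg n \<subseteq> range (toep n)"
    by (auto simp: toeplitz_alg_def poly_at_shift)
  have "toep n c \<in> toeplitz_alg n" for c
  proof -
    have "toep n c = toep n (coeff (Poly (map c [0..<n])))"
      by (rule eq_matI) (auto simp: toep_def nth_default_def)
    then show ?thesis unfolding toeplitz_alg_def poly_at_shift [symmetric] by blast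
  qed
  then show "range (toep n) \<subseteq> toeplitz_alg n" by blast
qed

lemma toep_in_alg [simp]: "toep n c \<in> toeplitz_alg n"
  by (simp add: toeplitz_alg_eq)

lemma shift_power_in_alg [simp]: "shift_power n k \<in> toeplitz_alg n"
  by (simp add: shift_power_def)

lemma toep_add: "toep n c + toep n d = toep n (\<lambda>k. c k + d k)"
  and toep_smult: "a \<cdot>\<^sub>m toep n c = toep n (\<lambda>k. a * c k)"
  and toep_one: "1\<^sub>m n = toep n (\<lambda>k. if k = 0 then 1 else 0)"
  and toep_zero: "0\<^sub>m n n = toep n (\<lambda>k. 0)"
  by (rule eq_matI; auto simp: toep_def)+

lemma one_in_alg [simp]: "1\<^sub>m n \<in> toeplitz_alg n"
  and zero_in_alg [simp]: "0\<^sub>m n n \<in> toeplitz_alg n"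
  by (simp_all add: toep_one toep_zero)

lemma smult_in_alg [simp]: "X \<in> toeplitz_alg n \<Longrightarrow> a \<cdot>\<^sub>m X \<in> toeplitz_alg n"
  by (auto simp: toeplitz_alg_eq toep_smult)

lemma add_in_alg [simp]: "X \<in> toeplitz_alg n \<Longrightarrow> Y \<in> toeplitz_alg n \<Longrightarrow> X + Y \<in> toeplitz_alg n"
  by (auto simp: toeplitz_alg_eq toep_add)

text \<open>Powers \<open>S\<^sup>k\<close> with \<open>k \<ge> n\<close> vanish; keeping them in the notation makes the relations
  between the images of the powers uniform.\<close>

lemma shift_power_zero: "n \<le> k \<Longrightarrow> shift_power n k = 0\<^sub>m n n"
  by (rule eq_matI) (auto simp: shift_power_def toep_def)

section \<open>Unital linear maps on the algebra and the images of the powers\<close>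

lemma unital_linear_onD:
  assumes "unital_linear_on n m \<phi>"
  shows "X \<in> toeplitz_alg n \<Longrightarrow> \<phi> X \<in> carrier_mat m m"
    and "X \<in> toeplitz_alg n \<Longrightarrow> Y \<in> toeplitz_alg n \<Longrightarrow> \<phi> (X + Y) = \<phi> X + \<phi> Y"
    and "X \<in> toeplitz_alg n \<Longrightarrow> \<phi> (a \<cdot>\<^sub>m X) = a \<cdot>\<^sub>m \<phi> X"
    and "\<phi> (1\<^sub>m n) = 1\<^sub>m m"
  using assms by (simp_all add: unital_linear_on_def)

lemma unital_linear_on_zero:
  assumes "unital_linear_on n m \<phi>"
  shows "\<phi> (0\<^sub>m n n) = 0\<^sub>m m m"
proof -
  have "(0 :: complex) \<cdot>\<^sub>m 0\<^sub>m n n = 0\<^sub>m n n" by (rule eq_matI) auto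
  then have "\<phi> (0\<^sub>m n n) = 0 \<cdot>\<^sub>m \<phi> (0\<^sub>m n n)"
    using unital_linear_onD(3) [OF assms zero_in_alg, of 0] by simp
  moreover have "\<phi> (0\<^sub>m n n) \<in> carrier_mat m m"
    by (rule unital_linear_onD(1) [OF assms zero_in_alg])
  then have "0 \<cdot>\<^sub>m \<phi> (0\<^sub>m n n) = 0\<^sub>m m m" by (intro eq_matI) auto
  ultimately show ?thesis by metis
qed

lemma unital_linear_on_toep:
  assumes lin: "unital_linear_on n m \<phi>" and ij: "i < m" "j < m"
  shows "\<phi> (toep n c) $$ (i,j) = (\<Sum>k<n. c k * \<phi> (shift_power n k) $$ (i,j))"
proof -
  have car: "\<phi> (toep n d) \<in> carrier_mat m m" for d
    by (simp add: unital_linear_onD [OF lin])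
  \<comment> \<open>Induction on the truncation length \<open>r\<close>, adding one power of the
    shift at a time.\<close>
  have "\<phi> (toep n (\<lambda>k. if k < r then c k else 0)) $$ (i,j) = (\<Sum>k<r. c k * \<phi> (shift_power n k) $$ (i,j))" for r
  proof (induction r)
    case 0
    then show ?case
      using ij unital_linear_on_zero [OF lin] by (simp add: toep_zero [symmetric])
  next
    case (Suc r)
    have "toep n (\<lambda>k. if k < Suc r then c k else 0)
        = toep n (\<lambda>k. if k < r then c k else 0) + c r \<cdot>\<^sub>m shift_power n r"
      by (rule eq_matI) (auto simp: toep_def shift_power_def less_Suc_eq)
    also have "\<phi> \<dots> = \<phi> (toep n (\<lambda>k. if k < r then c k else 0)) + c r \<cdot>\<^sub>m \<phi> (shift_power n r)"
      by (simp add: unital_linear_onD [OF lin])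
    finally show ?case
      using Suc.IH ij car [of "\<lambda>l. if l = r then 1 else 0"] by (simp add: shift_power_def [symmetric])
  qed
  moreover have "toep n (\<lambda>k. if k < n then c k else 0) = toep n c"
    by (rule eq_matI) (auto simp: toep_def)
  ultimately show ?thesis by metis
qed

text \<open>The matrix of \<open>T\<^sub>k\<close> in the form that \<open>mv\<close> and
  \<open>adj\<close> expect.\<close>

definition shift_im :: "(complex mat \<Rightarrow> complex mat) \<Rightarrow> nat \<Rightarrow> nat \<Rightarrow> nat \<Rightarrow> nat \<Rightarrow> complex" where
  "shift_im \<phi> n k i j = \<phi> (shift_power n k) $$ (i,j)"

lemma shift_im_zero:
  assumes "unital_linear_on n m \<phi>" "n \<le> k" "i < m"
  shows "mv {..<m} (shift_im \<phi> n k) x i = 0"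
  using assms by (simp add: mv_def shift_im_def shift_power_zero unital_linear_on_zero)

text \<open>Equal norms have the same upper bounds, here \<open>sqrt c\<close>. Read from right to
  left this gives upper estimates for the image; the other direction, contraposed, gives lower
  ones.\<close>

lemma completely_isometric_transfer:
  assumes lin: "unital_linear_on n m \<phi>" and iso: "completely_isometric_on n m \<phi>"
    and F: "\<And>a b. a < k \<Longrightarrow> b < k \<Longrightarrow> F a b \<in> toeplitz_alg n"
    and c: "0 \<le> c"
  shows "(\<forall>x. nsq ({..<k} \<times> {..<m}) (mv ({..<k} \<times> {..<m}) (blk (\<lambda>a b. \<phi> (F a b))) x) \<le> c * nsq ({..<k} \<times> {..<m}) x)
    \<longleftrightarrow> (\<forall>x. nsq ({..<k} \<times> {..<n}) (mv ({..<k} \<times> {..<n}) (blk F) x) \<le> c * nsq ({..<k} \<times> {..<n}) x)"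
proof -
  have "op_norm (block_mat k m m (\<lambda>a b. \<phi> (F a b))) = op_norm (block_mat k n n F)"
    using iso F by (simp add: completely_isometric_on_def)
  then have "op_norm (block_mat k m m (\<lambda>a b. \<phi> (F a b))) \<le> sqrt c \<longleftrightarrow> op_norm (block_mat k n n F) \<le> sqrt c"
    by simp
  then show ?thesis
    using c by (simp add: op_norm_block_le_iff)
qed

section \<open>Quadratic forms on block vectors\<close>

lemma nsq_Times: "nsq (I \<times> J) x = (\<Sum>a\<in>I. nsq J (\<lambda>i. x (a,i)))"
  by (simp add: nsq_def sum.cartesian_product)

lemma ip_Times: "ip (I \<times> J) x y = (\<Sum>a\<in>I. ip J (\<lambda>i. x (a,i)) (\<lambda>i. y (a,i)))"
  by (simp add: ip_def sum.cartesian_product)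

lemma mv_blk: "mv (I \<times> J) (blk F) x (a,i) = (\<Sum>b\<in>I. mv J (\<lambda>i j. F a b $$ (i,j)) (\<lambda>j. x (b,j)) i)"
  by (simp add: mv_def blk_def sum.cartesian_product split_def)

lemma mv_shift_power:
  "i < n \<Longrightarrow> mv {..<n} (\<lambda>i j. shift_power n k $$ (i,j)) x i = (if i + k < n then x (i + k) else 0)"
  by (simp add: mv_def shift_power_index if_distrib [of "\<lambda>z. z * _"] cong: if_cong)

text \<open>The three shifted copies of \<open>x\<close>, \<open>y\<close>, \<open>z\<close> inside \<open>\<ell>\<^sup>2\<close> realise the quadratic form as
  the squared norm of their sum: the powers of \<open>S\<close> are compressions of powers of a unitary shift.\<close>

lemma shift_block_positive:
  assumes ab: "a \<le> b"
  shows "0 \<le> nsq {..<n} x + nsq {..<n} y + nsq {..<n} z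
     + 2 * Re (ip {..<n} (mv {..<n} (\<lambda>i j. shift_power n a $$ (i,j)) x) y
             + ip {..<n} (mv {..<n} (\<lambda>i j. shift_power n b $$ (i,j)) x) z
             + ip {..<n} (mv {..<n} (\<lambda>i j. shift_power n (b - a) $$ (i,j)) y) z)"
proof -
  define e where "e p u s = (if p \<le> s \<and> s < p + n then u (s - p) else 0)"
    for p and u :: "nat \<Rightarrow> complex" and s
  let ?I = "{..<n + b}"
  have sh: "(\<Sum>s<n+b. if p \<le> s \<and> s < p + n then f (s - p) else 0) = sum f {..<n}" if "p \<le> b"
    for p and f :: "nat \<Rightarrow> complex"
  proof -
    have "(\<Sum>s<n+b. if p \<le> s \<and> s < p + n then f (s - p) else 0) = (\<Sum>s\<in>{p..<p+n}. f (s - p))"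
      using that by (intro sum.mono_neutral_cong_right) auto
    also have "\<dots> = sum f {..<n}"
      using sum.shift_bounds_nat_ivl [of "\<lambda>s. f (s - p)" 0 p n] by (simp add: lessThan_atLeast0 add.commute)
    finally show ?thesis .
  qed
  \<comment> \<open>Seen from the window of the copy at \<open>q\<close>, the copy at
    \<open>p\<close> is moved left by \<open>q - p\<close> with the part outside cut off, which is
    the action of that power of the shift.\<close>
  have ee: "ip ?I (e p u) (e q v) = ip {..<n} (mv {..<n} (\<lambda>i j. shift_power n (q - p) $$ (i,j)) u) v"
    if "p \<le> q" "q \<le> b" for p q u v
  proof -
    let ?f = "\<lambda>i. (if i + (q - p) < n then u (i + (q - p)) else 0) * cnj (v i)"
    have "ip ?I (e p u) (e q v) = (\<Sum>s<n+b. if q \<le> s \<and> s < q + n then ?f (s - q) else 0)"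
      unfolding ip_def e_def using that by (intro sum.cong refl) (auto intro!: arg_cong [of _ _ u])
    also have "\<dots> = sum ?f {..<n}" by (rule sh [OF that(2)])
    also have "\<dots> = ip {..<n} (mv {..<n} (\<lambda>i j. shift_power n (q - p) $$ (i,j)) u) v"
      unfolding ip_def by (intro sum.cong refl) (simp add: mv_shift_power)
    finally show ?thesis .
  qed
  have e0: "Re (ip ?I (e p u) (e p u)) = nsq {..<n} u" if "p \<le> b" for p u
  proof -
    have "ip ?I (e p u) (e p u) = ip {..<n} u u"
      unfolding ee [OF order_refl that] by (rule ip_cong) (simp_all add: mv_shift_power)
    then show ?thesis by (simp add: nsq_conv_ip)
  qed
  have "0 \<le> nsq ?I (\<lambda>s. e 0 x s + (e a y s + e b z s))" by simp
  also have "\<dots> = nsq {..<n} x + nsq {..<n} y + nsq {..<n} z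
     + 2 * Re (ip ?I (e 0 x) (e a y) + ip ?I (e 0 x) (e b z) + ip ?I (e a y) (e b z))"
    using ab unfolding nsq_conv_ip [of ?I] ip_add_left ip_add_right
    by (simp add: e0 ip_cnj [of ?I "e 0 x" "e a y"] ip_cnj [of ?I "e 0 x" "e b z"] ip_cnj [of ?I "e a y" "e b z"])
  finally show ?thesis using ab by (simp add: ee)
qed

section \<open>Orthonormal families\<close>

lemma ip_sum_left: "ip I (\<lambda>i. \<Sum>j\<in>J. c j * v j i) z = (\<Sum>j\<in>J. c j * ip I (v j) z)"
  unfolding ip_def by (simp add: sum_distrib_left sum_distrib_right mult_ac sum.swap [of _ J I])

lemma ip_sum_right: "ip I z (\<lambda>i. \<Sum>j\<in>J. c j * v j i) = (\<Sum>j\<in>J. cnj (c j) * ip I z (v j))"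
  by (simp add: ip_cnj [of I z] ip_sum_left)

lemma mv_sum: "mv K M (\<lambda>i. \<Sum>j\<in>J. c j * v j i) r = (\<Sum>j\<in>J. c j * mv K M (v j) r)"
  unfolding mv_def by (simp add: sum_distrib_left mult_ac sum.swap [of _ J K])

definition orthonormal :: "'a set \<Rightarrow> nat \<Rightarrow> (nat \<Rightarrow> 'a \<Rightarrow> complex) \<Rightarrow> bool" where
  "orthonormal I k u \<longleftrightarrow> (\<forall>i<k. \<forall>j<k. ip I (u i) (u j) = (if i = j then 1 else 0))"

lemma orthonormalD: "orthonormal I k u \<Longrightarrow> i < k \<Longrightarrow> j < k \<Longrightarrow> ip I (u i) (u j) = (if i = j then 1 else 0)"
  by (simp add: orthonormal_def)

lemma nsq_orthonormal_combination:
  assumes "orthonormal I k u"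
  shows "nsq I (\<lambda>s. \<Sum>j<k. c j * u j s) = nsq {..<k} c"
proof -
  have "ip I (\<lambda>s. \<Sum>j<k. c j * u j s) (\<lambda>s. \<Sum>j<k. c j * u j s)
      = (\<Sum>j<k. c j * (\<Sum>l<k. cnj (c l) * (if j = l then 1 else 0)))"
    unfolding ip_sum_left ip_sum_right using assms by (intro sum.cong) (auto simp: orthonormal_def)
  also have "\<dots> = ip {..<k} c c"
    unfolding ip_def by (intro sum.cong refl) (simp add: if_distrib [of "\<lambda>z. _ * z"] cong: if_cong)
  finally show ?thesis by (simp add: nsq_conv_ip)
qed

text \<open>Fewer than \<open>m\<close> linear conditions on \<open>m\<close> unknowns have a
  nonzero common solution. Padding the conditions with zero rows to a square matrix turns this into
  a vanishing determinant.\<close>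

lemma exists_unit_orthogonal:
  fixes m :: nat
  assumes "k < m"
  shows "\<exists>v. nsq {..<m} v = 1 \<and> (\<forall>i<k. ip {..<m} v (u i) = 0)"
proof -
  define A where "A = mat m m (\<lambda>(i,j). if i < k then cnj (u i j) else 0)"
  have A: "A \<in> carrier_mat m m" by (simp add: A_def)
  \<comment> \<open>Row \<open>k\<close> of \<open>A\<close> is the first padded zero row, so the
    transpose kills \<open>unit_vec m k\<close>.\<close>
  have "transpose_mat A *\<^sub>v unit_vec m k = 0\<^sub>v m"
    using assms by (intro eq_vecI) (simp_all add: A_def scalar_prod_right_unit)
  moreover have "unit_vec m k \<noteq> (0\<^sub>v m :: complex vec)" using assms by simp
  ultimately have "det (transpose_mat A) = 0"
    using det_0_iff_vec_prod_zero_field [of "transpose_mat A" m] A unit_vec_carrier by (metis transpose_carrier_mat)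
  then have "det A = 0" by (simp add: det_transpose [OF A])
  then obtain v where v: "v \<in> carrier_vec m" "v \<noteq> 0\<^sub>v m" "A *\<^sub>v v = 0\<^sub>v m"
    using det_0_iff_vec_prod_zero_field [OF A] by blast
  let ?v = "\<lambda>j. v $ j"
  have orth: "ip {..<m} ?v (u i) = 0" if "i < k" for i
  proof -
    have "(A *\<^sub>v v) $ i = ip {..<m} ?v (u i)"
      unfolding ip_def using that assms v(1)
      by (simp add: A_def scalar_prod_def lessThan_atLeast0 mult.commute)
    then show ?thesis using v that assms by simp
  qed
  have "nsq {..<m} ?v \<noteq> 0"
  proof
    assume "nsq {..<m} ?v = 0"
    then have "v = 0\<^sub>v m" using v(1) by (intro eq_vecI) (auto simp: nsq_eq_0_iff)
    with v(2) show False ..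
  qed
  then have s: "nsq {..<m} ?v > 0" using nsq_nonneg [of "{..<m}" ?v] by linarith
  let ?r = "complex_of_real (1 / sqrt (nsq {..<m} ?v))"
  have "(cmod ?r)\<^sup>2 * nsq {..<m} ?v = 1"
    using s by (simp add: norm_divide power_divide)
  then show ?thesis
    using orth by (intro exI [of _ "\<lambda>j. ?r * v $ j"]) (simp only: nsq_scale ip_scale_left, simp)
qed

lemma orthonormal_extend:
  assumes "orthonormal {..<m} k u" "k \<le> m"
  shows "\<exists>w. orthonormal {..<m} m w \<and> (\<forall>i<k. w i = u i)"
  using assms
proof (induction "m - k" arbitrary: k u)
  case 0
  then show ?case by auto
next
  case (Suc d)
  then have k: "k < m" by simp
  obtain v where v: "nsq {..<m} v = 1" "\<And>i. i < k \<Longrightarrow> ip {..<m} v (u i) = 0"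
    using exists_unit_orthogonal [OF k] by blast
  have "orthonormal {..<m} (Suc k) (u(k := v))"
    using Suc.prems(1) v(2) unfolding orthonormal_def
    by (auto simp: less_Suc_eq ip_self v(1) ip_cnj [of _ _ v])
  then obtain w where "orthonormal {..<m} m w" "\<forall>i<Suc k. w i = (u(k := v)) i"
    using Suc.hyps(1) [of "Suc k" "u(k := v)"] Suc.hyps(2) k
    by (metis Suc_leI diff_Suc_Suc diff_Suc_1 Suc_diff_Suc)
  then show ?case by (intro exI [of _ w]) auto
qed

lemma adjoint_frame_product:
  fixes m :: nat
  assumes "orthonormal {..<m} m w"
  shows "mat m m (\<lambda>(i,s). cnj (w i s)) * mat m m (\<lambda>(s,i). w i s) = 1\<^sub>m m"
  by (rule eq_matI)
     (use assms in \<open>auto simp: scalar_prod_def orthonormal_def ip_def lessThan_atLeast0 mult.commute\<close>)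

text \<open>A one-sided inverse of a square matrix is two-sided, so orthonormal columns give
  orthonormal rows.\<close>

lemma orthonormal_complete:
  assumes w: "orthonormal {..<m} m w" and "s < m" "t < m"
  shows "(\<Sum>i<m. w i s * cnj (w i t)) = (if s = t then 1 else 0)"
proof -
  have "mat m m (\<lambda>(s,i). w i s) * mat m m (\<lambda>(i,s). cnj (w i s)) = 1\<^sub>m m"
    by (rule mat_mult_left_right_inverse [OF _ _ adjoint_frame_product [OF w]]) simp_all
  then have "(mat m m (\<lambda>(s,i). w i s) * mat m m (\<lambda>(i,s). cnj (w i s))) $$ (s,t) = (1\<^sub>m m :: complex mat) $$ (s,t)"
    by simp
  then show ?thesis using assms(2,3) by (simp add: scalar_prod_def lessThan_atLeast0)
qed

lemma parseval:
  assumes w: "orthonormal {..<m} m w"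
  shows "(\<Sum>i<m. (cmod (ip {..<m} v (w i)))\<^sup>2) = nsq {..<m} v"
proof -
  have "v s = (\<Sum>i<m. ip {..<m} v (w i) * w i s)" if "s < m" for s
  proof -
    have "(\<Sum>i<m. ip {..<m} v (w i) * w i s) = (\<Sum>t<m. v t * (\<Sum>i<m. w i s * cnj (w i t)))"
      unfolding ip_def sum_distrib_left sum_distrib_right by (subst sum.swap) (simp add: mult_ac)
    also have "\<dots> = (\<Sum>t<m. if t = s then v t else 0)"
      using that by (intro sum.cong) (auto simp: orthonormal_complete [OF w])
    finally show ?thesis using that by simp
  qed
  then have "nsq {..<m} v = nsq {..<m} (\<lambda>s. \<Sum>i<m. ip {..<m} v (w i) * w i s)"
    by (intro nsq_cong) simp
  also have "\<dots> = nsq {..<m} (\<lambda>i. ip {..<m} v (w i))"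
    by (rule nsq_orthonormal_combination [OF w])
  finally show ?thesis by (simp add: nsq_def)
qed

text \<open>Otherwise the first \<open>m\<close> vectors already form a basis, and by Parseval the
  unit vector \<open>u m\<close>, orthogonal to all of them, is zero.\<close>

lemma orthonormal_card_le:
  assumes u: "orthonormal {..<m} n u"
  shows "n \<le> m"
proof (rule ccontr)
  assume "\<not> n \<le> m"
  then have "orthonormal {..<m} m u" "m < n"
    using u by (auto simp: orthonormal_def)
  from parseval [OF this(1), of "u m"] this(2) u have "nsq {..<m} (u m) = 0"
    by (simp add: orthonormal_def)
  moreover have "nsq {..<m} (u m) = 1"
    using orthonormalD [OF u \<open>m < n\<close> \<open>m < n\<close>] by (simp add: nsq_conv_ip)
  ultimately show False by simp
qed

section \<open>Positivity and norming vectors\<close>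

lemma mv_minus: "mv J M (\<lambda>j. - x j) i = - mv J M x i"
  by (simp add: mv_def sum_negf)

lemma mv_scale: "mv J M (\<lambda>j. c * x j) i = c * mv J M x i"
  by (simp add: mv_def sum_distrib_left mult_ac)

text \<open>The bound of \<open>accretive_imp_bound\<close> for \<open>1 - t K\<close> passes to the
  image, which is \<open>1 - t \<phi>(K)\<close> because \<open>\<phi>\<close> is linear and unital;
  \<open>bound_imp_accretive\<close> then returns to positivity.\<close>

lemma accretive_transfer:
  assumes lin: "unital_linear_on n m \<phi>" and iso: "completely_isometric_on n m \<phi>"
    and K: "\<And>r s. r < k \<Longrightarrow> s < k \<Longrightarrow> K r s \<in> toeplitz_alg n"
    and acc: "\<And>x. 0 \<le> Re (ip ({..<k} \<times> {..<n}) (mv ({..<k} \<times> {..<n}) (blk K) x) x)"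
  shows "0 \<le> Re (ip ({..<k} \<times> {..<m}) (mv ({..<k} \<times> {..<m}) (blk (\<lambda>r s. \<phi> (K r s))) x) x)"
proof -
  define F where "F t r s = (if r = s then 1\<^sub>m n else 0\<^sub>m n n) + (- complex_of_real t) \<cdot>\<^sub>m K r s" for t r s
  have F: "F t r s \<in> toeplitz_alg n" if "r < k" "s < k" for t r s
    unfolding F_def using K that by simp
  have \<phi>F: "\<phi> (F t r s) = (if r = s then 1\<^sub>m m else 0\<^sub>m m m) + (- complex_of_real t) \<cdot>\<^sub>m \<phi> (K r s)"
    if "r < k" "s < k" for t r s
  proof -
    have "\<phi> (F t r s) = \<phi> (if r = s then 1\<^sub>m n else 0\<^sub>m n n) + (- complex_of_real t) \<cdot>\<^sub>m \<phi> (K r s)"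
      using K [OF that] unfolding F_def by (simp add: unital_linear_onD [OF lin])
    then show ?thesis by (simp add: unital_linear_onD [OF lin] unital_linear_on_zero [OF lin])
  qed
  \<comment> \<open>Stated for general blocks in order to serve both size \<open>n\<close> and size
    \<open>m\<close>.\<close>
  have pert: "mv (I \<times> J) (blk G) x r = x r - complex_of_real t * mv (I \<times> J) (blk L) x r"
    if "finite I" "finite J" "r \<in> I \<times> J"
      and pert: "\<And>r s i j. r \<in> I \<Longrightarrow> s \<in> I \<Longrightarrow> i \<in> J \<Longrightarrow> j \<in> J \<Longrightarrow>
         G r s $$ (i,j) = (if (r,i) = (s,j) then 1 else 0) - complex_of_real t * L r s $$ (i,j)"
    for G L :: "nat \<Rightarrow> nat \<Rightarrow> complex mat" and t I J x r
  proof -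
    have entry: "blk G r s = (if r = s then 1 else 0) - complex_of_real t * blk L r s" if "s \<in> I \<times> J" for s
      using that \<open>r \<in> I \<times> J\<close> pert by (auto simp: blk_def prod_eq_iff)
    have "mv (I \<times> J) (blk G) x r
        = (\<Sum>s\<in>I \<times> J. (if r = s then x s else 0) - complex_of_real t * (blk L r s * x s))"
      unfolding mv_def by (intro sum.cong refl) (simp add: entry left_diff_distrib)
    also have "\<dots> = x r - complex_of_real t * mv (I \<times> J) (blk L) x r"
      using that(1-3) by (simp add: sum_subtractf sum_distrib_left mv_def)
    finally show ?thesis .
  qed
  have Kcar: "K r s \<in> carrier_mat n n" "\<phi> (K r s) \<in> carrier_mat m m" if "r < k" "s < k" for r s
    using K [OF that] unital_linear_onD(1) [OF lin] by (auto simp: toeplitz_alg_eq)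
  have n: "mv ({..<k} \<times> {..<n}) (blk (F t)) x r
      = x r - complex_of_real t * mv ({..<k} \<times> {..<n}) (blk K) x r" if "r \<in> {..<k} \<times> {..<n}" for t x r
    by (rule pert) (use that in \<open>auto simp: F_def carrier_matD [OF Kcar(1)]\<close>)
  have m: "mv ({..<k} \<times> {..<m}) (blk (\<lambda>r s. \<phi> (F t r s))) x r
      = x r - complex_of_real t * mv ({..<k} \<times> {..<m}) (blk (\<lambda>r s. \<phi> (K r s))) x r"
    if "r \<in> {..<k} \<times> {..<m}" for t x r
    by (rule pert) (use that in \<open>auto simp: \<phi>F carrier_matD [OF Kcar(2)]\<close>)
  obtain C where C: "C \<ge> 0"
    "\<And>t x. t \<ge> 0 \<Longrightarrow> nsq ({..<k} \<times> {..<n}) (\<lambda>r. x r - complex_of_real t * mv ({..<k} \<times> {..<n}) (blk K) x r)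
      \<le> (1 + t\<^sup>2 * C) * nsq ({..<k} \<times> {..<n}) x"
    using accretive_imp_bound [OF _ acc] by auto
  show ?thesis
  proof (rule bound_imp_accretive [where C = C])
    fix t :: real
    assume t: "0 \<le> t"
    have "\<forall>x. nsq ({..<k} \<times> {..<n}) (mv ({..<k} \<times> {..<n}) (blk (F t)) x) \<le> (1 + t\<^sup>2 * C) * nsq ({..<k} \<times> {..<n}) x"
      using C(2) [OF t] by (simp only: nsq_cong [OF n] simp_thms)
    then have "nsq ({..<k} \<times> {..<m}) (mv ({..<k} \<times> {..<m}) (blk (\<lambda>r s. \<phi> (F t r s))) x)
        \<le> (1 + t\<^sup>2 * C) * nsq ({..<k} \<times> {..<m}) x"
      using completely_isometric_transfer [where F = "F t" and k = k and c = "1 + t\<^sup>2 * C", OF lin iso F] C(1) by simp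
    then show "nsq ({..<k} \<times> {..<m}) (\<lambda>r. x r - complex_of_real t * mv ({..<k} \<times> {..<m}) (blk (\<lambda>r s. \<phi> (K r s))) x r)
        \<le> (1 + t\<^sup>2 * C) * nsq ({..<k} \<times> {..<m}) x"
      by (simp only: nsq_cong [OF m])
  qed
qed

lemma three_block_form:
  assumes diag: "\<And>r. r < 3 \<Longrightarrow> K r r = (1/2) \<cdot>\<^sub>m 1\<^sub>m d"
    and up: "\<And>r s. r < s \<Longrightarrow> s < 3 \<Longrightarrow> K r s = 0\<^sub>m d d"
  shows "2 * Re (ip ({..<3} \<times> {..<d}) (mv ({..<3} \<times> {..<d}) (blk K) u) u)
    = nsq {..<d} (\<lambda>i. u (0,i)) + nsq {..<d} (\<lambda>i. u (1,i)) + nsq {..<d} (\<lambda>i. u (2,i))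
     + 2 * Re (ip {..<d} (mv {..<d} (\<lambda>i j. K 1 0 $$ (i,j)) (\<lambda>i. u (0,i))) (\<lambda>i. u (1,i))
             + ip {..<d} (mv {..<d} (\<lambda>i j. K 2 0 $$ (i,j)) (\<lambda>i. u (0,i))) (\<lambda>i. u (2,i))
             + ip {..<d} (mv {..<d} (\<lambda>i j. K 2 1 $$ (i,j)) (\<lambda>i. u (1,i))) (\<lambda>i. u (2,i)))"
proof -
  let ?J = "{..<d}"
  have half: "ip ?J (mv ?J (\<lambda>i j. K r r $$ (i,j)) v) w = ip ?J v w / 2" if "r < 3" for r v w
  proof -
    have "ip ?J (mv ?J (\<lambda>i j. K r r $$ (i,j)) v) w = ip ?J (\<lambda>i. (1/2) * v i) w"
    proof (intro ip_cong refl)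
      fix i assume "i \<in> ?J"
      then have "mv ?J (\<lambda>i j. K r r $$ (i,j)) v i = (\<Sum>j<d. if j = i then (1/2) * v j else 0)"
        unfolding mv_def using that by (intro sum.cong) (auto simp: diag)
      then show "mv ?J (\<lambda>i j. K r r $$ (i,j)) v i = (1/2) * v i" using \<open>i \<in> ?J\<close> by simp
    qed
    then show ?thesis by (simp only: ip_scale_left) simp
  qed
  have zero: "ip ?J (mv ?J (\<lambda>i j. K r s $$ (i,j)) v) w = 0" if "r < s" "s < 3" for r s v w
    using that by (simp add: ip_def mv_def up)
  have I: "{..<3} = {0, 1, 2::nat}" by auto
  show ?thesis
    unfolding ip_Times mv_blk I
    by (simp add: ip_add_left half zero ip_self)
qed

text \<open>The positivity in \<open>shift_block_positive\<close>, carried to the images by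
  \<open>accretive_transfer\<close>.\<close>

lemma image_block_positive:
  assumes lin: "unital_linear_on n m \<phi>" and iso: "completely_isometric_on n m \<phi>" and ab: "a \<le> b"
  shows "0 \<le> nsq {..<m} x + nsq {..<m} y + nsq {..<m} z
     + 2 * Re (ip {..<m} (mv {..<m} (shift_im \<phi> n a) x) y
             + ip {..<m} (mv {..<m} (shift_im \<phi> n b) x) z
             + ip {..<m} (mv {..<m} (shift_im \<phi> n (b - a)) y) z)"
proof -
  define K where "K r s = (if r = s then (1/2) \<cdot>\<^sub>m 1\<^sub>m n else if r < s then 0\<^sub>m n n
      else if r = 1 then shift_power n a else if s = 0 then shift_power n b else shift_power n (b - a))"
    for r s :: nat
  have K: "K r s \<in> toeplitz_alg n" for r s
    by (simp add: K_def)
  have acc: "0 \<le> Re (ip ({..<3} \<times> {..<n}) (mv ({..<3} \<times> {..<n}) (blk K) u) u)" for u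
  proof -
    have "0 \<le> 2 * Re (ip ({..<3} \<times> {..<n}) (mv ({..<3} \<times> {..<n}) (blk K) u) u)"
      using shift_block_positive [OF ab, of n "\<lambda>i. u (0,i)" "\<lambda>i. u (1,i)" "\<lambda>i. u (2,i)"]
      by (subst three_block_form) (simp_all add: K_def)
    then show ?thesis by simp
  qed
  define u where "u r = (if fst r = 0 then x (snd r) else if fst r = 1 then y (snd r) else z (snd r))"
    for r :: "nat \<times> nat"
  have "0 \<le> 2 * Re (ip ({..<3} \<times> {..<m}) (mv ({..<3} \<times> {..<m}) (blk (\<lambda>r s. \<phi> (K r s))) u) u)"
    using accretive_transfer [OF lin iso K acc] by simp
  moreover have "\<phi> (K r r) = (1/2) \<cdot>\<^sub>m 1\<^sub>m m" for r
    by (simp add: K_def unital_linear_onD [OF lin])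
  moreover have "\<phi> (K r s) = 0\<^sub>m m m" if "r < s" for r s
    using that unital_linear_on_zero [OF lin] by (simp add: K_def)
  ultimately show ?thesis
    by (subst (asm) three_block_form) (simp_all add: K_def u_def shift_im_def [abs_def])
qed

text \<open>Compactness of the unit sphere: unit vectors reaching at least
  \<open>C * (1 - 1 / (k + 1))\<close> have a subsequence converging in every coordinate, and both
  squared norms are continuous.\<close>

lemma sup_attained:
  assumes fin: "finite I" "finite J" and C: "0 < C"
    and big: "\<And>c. 0 \<le> c \<Longrightarrow> c < C \<Longrightarrow> \<exists>x. c * nsq J x < nsq I (mv J M x)"
  shows "\<exists>x. nsq J x = 1 \<and> C \<le> nsq I (mv J M x)"
proof -
  have "\<exists>x. nsq J x = 1 \<and> C * (1 - 1 / real (Suc k)) \<le> nsq I (mv J M x)" for k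
  proof -
    let ?c = "C * (1 - 1 / real (Suc k))"
    have "0 \<le> ?c" "?c < C" using C by (simp_all add: field_simps)
    then obtain x where x: "?c * nsq J x < nsq I (mv J M x)" using big by blast
    have "nsq J x \<noteq> 0"
    proof
      assume "nsq J x = 0"
      then have "\<forall>j\<in>J. x j = 0" using fin by (simp add: nsq_eq_0_iff)
      then have "nsq I (mv J M x) = 0" by (simp add: nsq_def mv_def)
      with x \<open>nsq J x = 0\<close> show False by simp
    qed
    then have s: "nsq J x > 0" using nsq_nonneg [of J x] by linarith
    let ?r = "complex_of_real (1 / sqrt (nsq J x))"
    have r: "(cmod ?r)\<^sup>2 = 1 / nsq J x"
      using s by (simp add: norm_divide power_divide)
    have "nsq J (\<lambda>j. ?r * x j) = 1" unfolding nsq_scale r using s by simp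
    moreover have "nsq I (mv J M (\<lambda>j. ?r * x j)) = nsq I (mv J M x) / nsq J x"
      unfolding mv_scale [abs_def] nsq_scale r by simp
    moreover have "?c \<le> nsq I (mv J M x) / nsq J x" using x s by (simp add: pos_le_divide_eq)
    ultimately show ?thesis by metis
  qed
  then obtain x where x: "\<And>k. nsq J (x k) = 1" "\<And>k. C * (1 - 1 / real (Suc k)) \<le> nsq I (mv J M (x k))"
    by metis
  have x1: "cmod (x k j) \<le> 1" if "j \<in> J" for k j
  proof -
    have "(cmod (x k j))\<^sup>2 \<le> nsq J (x k)"
      unfolding nsq_def by (rule member_le_sum [OF that]) (simp_all add: fin)
    then show ?thesis by (simp add: x(1) power_le_one_iff abs_square_le_1)
  qed
  \<comment> \<open>The Boolean selects the real or imaginary part, so that the real Bolzano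
    argument applies.\<close>
  define f where "f k p = (if snd p then Re (x k (fst p)) else Im (x k (fst p)))" for k and p :: "'b \<times> bool"
  have f1: "\<bar>f k p\<bar> \<le> 1" if "p \<in> J \<times> UNIV" for k p
    using that x1 unfolding f_def
    by (auto intro: order_trans [OF abs_Re_le_cmod] order_trans [OF abs_Im_le_cmod])
  have "finite (J \<times> (UNIV :: bool set))" using fin by simp
  from finite_pointwise_bolzano [where f = f, OF this f1] obtain r where r: "strict_mono (r :: nat \<Rightarrow> nat)" "\<forall>p\<in>J \<times> UNIV. convergent (\<lambda>k. f (r k) p)"
    by blast
  have "\<exists>l. (\<lambda>k. x (r k) j) \<longlonglongrightarrow> l" if "j \<in> J" for j
  proof -
    have "convergent (\<lambda>k. f (r k) (j, c))" for c
      using r(2) that by (meson SigmaI UNIV_I)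
    then obtain a b where "(\<lambda>k. f (r k) (j, True)) \<longlonglongrightarrow> a" "(\<lambda>k. f (r k) (j, False)) \<longlonglongrightarrow> b"
      unfolding convergent_def by meson
    then have "(\<lambda>k. Complex (Re (x (r k) j)) (Im (x (r k) j))) \<longlonglongrightarrow> Complex a b"
      by (intro tendsto_Complex) (simp_all add: f_def)
    then show ?thesis by (auto simp del: Complex_eq)
  qed
  then obtain l where l: "\<And>j. j \<in> J \<Longrightarrow> (\<lambda>k. x (r k) j) \<longlonglongrightarrow> l j" by metis
  have "(\<lambda>k. nsq J (x (r k))) \<longlonglongrightarrow> nsq J l"
    unfolding nsq_def by (intro tendsto_intros l)
  then have "nsq J l = 1" by (simp add: x(1) LIMSEQ_const_iff)
  moreover have "C * (1 - 0) \<le> nsq I (mv J M l)"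
  proof (rule LIMSEQ_le)
    have "(\<lambda>k. C * (1 - 1 / real (Suc k))) \<longlonglongrightarrow> C * (1 - 0)"
      by (intro tendsto_intros) (rule LIMSEQ_inverse_real_of_nat [unfolded inverse_eq_divide])
    from LIMSEQ_subseq_LIMSEQ [OF this r(1)]
    show "(\<lambda>k. C * (1 - 1 / real (Suc (r k)))) \<longlonglongrightarrow> C * (1 - 0)" by (simp add: o_def)
    show "(\<lambda>k. nsq I (mv J M (x (r k)))) \<longlonglongrightarrow> nsq I (mv J M l)"
      unfolding nsq_def mv_def by (intro tendsto_intros l)
  qed (use x(2) in blast)
  ultimately show ?thesis by auto
qed

text \<open>Put \<open>y = - T\<^sub>k x\<close> and \<open>z = 0\<close> into the positive form
  with both exponents equal to \<open>k\<close>.\<close>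

lemma image_contractive:
  assumes "unital_linear_on n m \<phi>" "completely_isometric_on n m \<phi>"
  shows "nsq {..<m} (mv {..<m} (shift_im \<phi> n k) x) \<le> nsq {..<m} x"
proof -
  let ?g = "mv {..<m} (shift_im \<phi> n k) x"
  have z: "nsq {..<m} (\<lambda>i. 0) = 0" "ip {..<m} u (\<lambda>i. 0) = 0" for u
    by (simp_all add: nsq_def ip_def)
  have "0 \<le> nsq {..<m} x + nsq {..<m} ?g - 2 * nsq {..<m} ?g"
    using image_block_positive [OF assms, of k k x "\<lambda>i. - ?g i" "\<lambda>i. 0"]
    unfolding z nsq_minus ip_minus_right ip_self by simp
  then show ?thesis by simp
qed

text \<open>A unit vector attains squared norm at least \<open>n\<close> on the column of the
  \<open>n\<close> contractions; no summand exceeds \<open>1\<close>, so each equals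
  \<open>1\<close>.\<close>

lemma exists_common_norming_vector:
  assumes lin: "unital_linear_on n m \<phi>" and iso: "completely_isometric_on n m \<phi>" and n: "1 \<le> n"
  shows "\<exists>x. nsq {..<m} x = 1 \<and> (\<forall>k<n. nsq {..<m} (mv {..<m} (shift_im \<phi> n k) x) = 1)"
proof -
  \<comment> \<open>The column is padded with zero blocks to the square shape in which complete
    isometry is stated.\<close>
  define F where "F r s = (if s = 0 then shift_power n r else 0\<^sub>m n n)" for r s :: nat
  have F: "F r s \<in> toeplitz_alg n" for r s by (simp add: F_def)
  define M where "M p j = shift_im \<phi> n (fst p) (snd p) j" for p :: "nat \<times> nat" and j
  have M: "mv {..<m} M x (k,i) = mv {..<m} (shift_im \<phi> n k) x i" for x k i
    by (simp add: mv_def M_def)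
  have "\<exists>x. c * nsq {..<m} x < nsq ({..<n} \<times> {..<m}) (mv {..<m} M x)" if c: "0 \<le> c" "c < real n" for c
  proof -
    \<comment> \<open>The last basis vector in block \<open>0\<close>: the \<open>k\<close>-th power
      of the shift moves it to position \<open>n - 1 - k\<close>, so all \<open>n\<close> powers
      keep its length.\<close>
    define e where "e p = (if p = (0, n - 1) then 1 else 0 :: complex)" for p :: "nat \<times> nat"
    have "nsq ({..<n} \<times> {..<n}) e = 1"
    proof -
      have "nsq ({..<n} \<times> {..<n}) e = (\<Sum>p\<in>{..<n} \<times> {..<n}. if p = (0, n - 1) then 1 else 0)"
        unfolding nsq_def e_def by (intro sum.cong) auto
      then show ?thesis using n by simp
    qed
    moreover have "nsq ({..<n} \<times> {..<n}) (mv ({..<n} \<times> {..<n}) (blk F) e) = real n"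
    proof -
      have "mv ({..<n} \<times> {..<n}) (blk F) e (k,i) = (if i = n - 1 - k then 1 else 0)" if "k < n" "i < n" for k i
      proof -
        have "mv ({..<n} \<times> {..<n}) (blk F) e (k,i)
            = (\<Sum>p\<in>{..<n} \<times> {..<n}. if p = (0, n - 1) then shift_power n k $$ (i, n - 1) else 0)"
          unfolding mv_def by (intro sum.cong) (auto simp: blk_def F_def e_def)
        also have "\<dots> = shift_power n k $$ (i, n - 1)" using n by simp
        finally show ?thesis using that by (auto simp: shift_power_index)
      qed
      then have "nsq {..<n} (\<lambda>i. mv ({..<n} \<times> {..<n}) (blk F) e (k,i)) = 1" if "k < n" for k
        using that by (simp add: nsq_def if_distrib [of "\<lambda>z. (cmod z)\<^sup>2"] cong: if_cong)
      then show ?thesis by (simp add: nsq_Times)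
    qed
    ultimately have "\<not> (\<forall>x. nsq ({..<n} \<times> {..<n}) (mv ({..<n} \<times> {..<n}) (blk F) x) \<le> c * nsq ({..<n} \<times> {..<n}) x)"
      using c by (metis mult.right_neutral not_le)
    then obtain x where x: "c * nsq ({..<n} \<times> {..<m}) x
        < nsq ({..<n} \<times> {..<m}) (mv ({..<n} \<times> {..<m}) (blk (\<lambda>r s. \<phi> (F r s))) x)"
      using completely_isometric_transfer [OF lin iso F c(1), where k = n] by (meson not_le)
    \<comment> \<open>Only block \<open>0\<close> of \<open>x\<close> meets nonzero blocks; dropping
      the others can only lower the right-hand norm.\<close>
    have "nsq {..<m} (\<lambda>i. x (0,i)) \<le> nsq ({..<n} \<times> {..<m}) x"
      unfolding nsq_Times using n by (intro member_le_sum) auto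
    then have "c * nsq {..<m} (\<lambda>i. x (0,i)) \<le> c * nsq ({..<n} \<times> {..<m}) x"
      using c(1) by (rule mult_left_mono)
    also note x
    also have "nsq ({..<n} \<times> {..<m}) (mv ({..<n} \<times> {..<m}) (blk (\<lambda>r s. \<phi> (F r s))) x)
        = nsq ({..<n} \<times> {..<m}) (mv {..<m} M (\<lambda>i. x (0,i)))"
    proof (rule nsq_cong)
      fix p assume "p \<in> {..<n} \<times> {..<m}"
      then obtain k i where p: "p = (k,i)" "k < n" "i < m" by auto
      have "mv {..<m} (\<lambda>i j. \<phi> (F k b) $$ (i,j)) (\<lambda>j. x (b,j)) i
          = (if b = 0 then mv {..<m} M (\<lambda>i. x (0,i)) p else 0)" for b
      proof (cases "b = 0")
        case True
        then have "mv {..<m} (\<lambda>i j. \<phi> (F k b) $$ (i,j)) (\<lambda>j. x (b,j)) i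
            = mv {..<m} (shift_im \<phi> n k) (\<lambda>j. x (0,j)) i"
          unfolding F_def shift_im_def mv_def by simp
        with True show ?thesis unfolding p(1) M by simp
      next
        case False
        then show ?thesis using p by (simp add: F_def mv_def unital_linear_on_zero [OF lin])
      qed
      then show "mv ({..<n} \<times> {..<m}) (blk (\<lambda>r s. \<phi> (F r s))) x p = mv {..<m} M (\<lambda>i. x (0,i)) p"
        using n unfolding p(1) mv_blk by simp
    qed
    finally show ?thesis by blast
  qed
  then obtain x where x: "nsq {..<m} x = 1" "real n \<le> nsq ({..<n} \<times> {..<m}) (mv {..<m} M x)"
    using sup_attained [of "{..<n} \<times> {..<m}" "{..<m}" "real n" M] n by auto
  have le: "nsq {..<m} (mv {..<m} (shift_im \<phi> n k) x) \<le> 1" for k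
    using image_contractive [OF lin iso, of k x] x(1) by simp
  have "nsq {..<m} (mv {..<m} (shift_im \<phi> n k) x) = 1" if "k < n" for k
  proof (rule ccontr)
    assume "nsq {..<m} (mv {..<m} (shift_im \<phi> n k) x) \<noteq> 1"
    with le [of k] have "nsq {..<m} (mv {..<m} (shift_im \<phi> n k) x) < 1" by simp
    then have "(\<Sum>k<n. nsq {..<m} (mv {..<m} (shift_im \<phi> n k) x)) < (\<Sum>k<n. 1)"
      using le that by (intro sum_strict_mono_ex1) auto
    then show False using x(2) by (simp add: nsq_Times M)
  qed
  with x(1) show ?thesis by blast
qed

text \<open>Testing with \<open>z = - u\<close> leaves minus the squared norm of
  \<open>u\<close>.\<close>

lemma zero_if_form_nonneg:
  assumes "finite I" "\<And>z. 0 \<le> nsq I z + 2 * Re (ip I u z)" "i \<in> I"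
  shows "u i = 0"
proof -
  have "0 \<le> nsq I (\<lambda>i. - u i) + 2 * Re (ip I u (\<lambda>i. - u i))" by (rule assms(2))
  then have "nsq I u \<le> 0" by (simp add: nsq_minus ip_minus_right ip_self)
  then have "nsq I u = 0" using nsq_nonneg [of I u] by linarith
  then show ?thesis using assms by (simp add: nsq_eq_0_iff)
qed

text \<open>Where \<open>\<parallel>T\<^sub>j x\<parallel> = \<parallel>x\<parallel>\<close>, the pair \<open>(x, - T\<^sub>j x)\<close> annihilates the corresponding two slots of the positive
  form, so the third slot must be orthogonal to what remains. The three placements of the
  pair give the three relations.\<close>

lemma image_norming_relations:
  fixes x :: "nat \<Rightarrow> complex" and n m :: nat and \<phi> :: "complex mat \<Rightarrow> complex mat"
  defines "T \<equiv> \<lambda>k. mv {..<m} (shift_im \<phi> n k)" and "T' \<equiv> \<lambda>k. mv {..<m} (adj (shift_im \<phi> n k))"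
  assumes lin: "unital_linear_on n m \<phi>" and iso: "completely_isometric_on n m \<phi>"
    and x: "nsq {..<m} x = 1" and Tx: "nsq {..<m} (T j x) = 1" and i: "i < m"
  shows "T a (T j x) i = T (a + j) x i"
    and "a \<le> j \<Longrightarrow> T' a (T j x) i = T (j - a) x i"
    and "T' (a + j) (T j x) i = T' a x i"
proof -
  let ?J = "{..<m}"
  define g where "g = T j x"
  have g: "nsq ?J g = 1" "ip ?J (T j x) g = 1" using Tx by (simp_all add: g_def ip_self)
  have pos: "0 \<le> nsq ?J u + nsq ?J v + nsq ?J w
     + 2 * Re (ip ?J (T a u) v + ip ?J (T b u) w + ip ?J (T (b - a) v) w)" if "a \<le> b" for a b u v w
    unfolding T_def using image_block_positive [OF lin iso that] .
  \<comment> \<open>When the free vector sits in the first or second slot it occurs inside some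
    \<open>T k\<close>; the adjoint brings it out.\<close>
  have adjR: "Re (ip ?J (T k u) v) = Re (ip ?J (T' k v) u)" for k u v
    unfolding T_def T'_def by (simp add: ip_mv_adj ip_cnj [of ?J u])
  have neg: "T k (\<lambda>i. - u i) = (\<lambda>i. - T k u i)" for k u
    unfolding T_def by (rule ext) (rule mv_minus)
  have i': "i \<in> ?J" using i by simp
  \<comment> \<open>Free third slot: the exponents \<open>j\<close> and \<open>a + j\<close> make
    the remaining one equal to \<open>a\<close>.\<close>
  have "0 \<le> nsq ?J z + 2 * Re (ip ?J (\<lambda>i. T (a + j) x i - T a g i) z)" for z
    using pos [of j "a + j" x "\<lambda>i. - g i" z]
    by (simp add: g x nsq_minus neg ip_minus_left ip_minus_right ip_diff_left)
  from zero_if_form_nonneg [OF _ this i'] show "T a (T j x) i = T (a + j) x i"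
    by (simp add: g_def)
  have "0 \<le> nsq ?J y + 2 * Re (ip ?J (\<lambda>i. T' a x i - T' (a + j) g i) y)" for y
    using pos [of a "a + j" y x "\<lambda>i. - g i"]
    by (simp add: g x nsq_minus neg ip_minus_left ip_minus_right ip_diff_left adjR [of a y x] adjR [of "a + j" y g])
  from zero_if_form_nonneg [OF _ this i'] show "T' (a + j) (T j x) i = T' a x i"
    by (simp add: g_def)
  show "T' a (T j x) i = T (j - a) x i" if a: "a \<le> j"
  proof -
    \<comment> \<open>Free middle slot: the pair sits in the outer slots, which carry exponent
      \<open>j\<close>.\<close>
    have "0 \<le> nsq ?J y + 2 * Re (ip ?J (\<lambda>i. T (j - a) x i - T' a g i) y)" for y
      using pos [of "j - a" j x y "\<lambda>i. - g i"] a
      by (simp add: g x nsq_minus neg ip_minus_left ip_minus_right ip_diff_left adjR [of a y g])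
    from zero_if_form_nonneg [OF _ this i'] show ?thesis by (simp add: g_def)
  qed
qed

section \<open>The reducing subspace\<close>

text \<open>Invariance under all \<open>T\<^sub>k\<close> and all their adjoints makes the span of
  \<open>g\<close> reducing.\<close>

lemma exists_shift_frame:
  fixes n m :: nat
  assumes lin: "unital_linear_on n m \<phi>" and iso: "completely_isometric_on n m \<phi>" and n: "1 \<le> n"
  shows "\<exists>g. orthonormal {..<m} n g
    \<and> (\<forall>i<n. \<forall>k. \<forall>s<m. mv {..<m} (shift_im \<phi> n k) (g i) s = (if k \<le> i then g (i - k) s else 0))
    \<and> (\<forall>i<n. \<forall>k. \<forall>s<m. mv {..<m} (adj (shift_im \<phi> n k)) (g i) s = (if i + k < n then g (i + k) s else 0))"
proof -
  let ?T = "\<lambda>k. mv {..<m} (shift_im \<phi> n k)" and ?T' = "\<lambda>k. mv {..<m} (adj (shift_im \<phi> n k))"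
  obtain x where x: "nsq {..<m} x = 1" "\<And>k. k < n \<Longrightarrow> nsq {..<m} (?T k x) = 1"
    using exists_common_norming_vector [OF lin iso n] by blast
  note rel = image_norming_relations [OF lin iso x]
  have Tz: "?T k u s = 0" if "n \<le> k" "s < m" for k u s
    using shift_im_zero [OF lin that] .
  have T'z: "?T' k u s = 0" if "n \<le> k" "s < m" for k u s
    using that by (simp add: mv_def adj_def shift_im_def shift_power_zero unital_linear_on_zero [OF lin])
  \<comment> \<open>By the third relation this vector is the adjoint of
    \<open>T\<^sub>k\<^sub>+\<^sub>n\<^sub>-\<^sub>1\<close> applied to
    \<open>T\<^sub>n\<^sub>-\<^sub>1 x\<close>, and powers of order at least \<open>n\<close>
    vanish.\<close>
  have T'x: "?T' k x s = 0" if "1 \<le> k" "s < m" for k s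
    using rel(3) [of "n - 1" s k] T'z [of "k + (n - 1)" s] n that by simp
  \<comment> \<open>Reversed order, because the shift lowers the index of a basis vector.\<close>
  define g where "g i = ?T (n - 1 - i) x" for i
  have T: "?T k (g i) s = (if k \<le> i then g (i - k) s else 0)" if "i < n" "s < m" for i k s
  proof (cases "k \<le> i")
    case True
    then have "k + (n - 1 - i) = n - 1 - (i - k)" using that by simp
    then show ?thesis using rel(1) [of "n - 1 - i" s k] that True by (simp add: g_def)
  next
    case False
    then have "n \<le> k + (n - 1 - i)" using that by simp
    then show ?thesis using rel(1) [of "n - 1 - i" s k] Tz that False by (simp add: g_def)
  qed
  have T': "?T' k (g i) s = (if i + k < n then g (i + k) s else 0)" if "i < n" "s < m" for i k s
  proof (cases "i + k < n")
    case True
    then have "k \<le> n - 1 - i" "n - 1 - i - k = n - 1 - (i + k)" by simp_all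
    then show ?thesis using rel(2) [of "n - 1 - i" s k] that True by (simp add: g_def)
  next
    case False
    \<comment> \<open>The adjoint first undoes \<open>n - 1 - i\<close> steps back to
      \<open>x\<close>; at least one step remains and kills \<open>x\<close>.\<close>
    then have "k = (k - (n - 1 - i)) + (n - 1 - i)" "1 \<le> k - (n - 1 - i)" using that by simp_all
    then show ?thesis using rel(3) [of "n - 1 - i" s "k - (n - 1 - i)"] T'x that False by (simp add: g_def)
  qed
  have g1: "ip {..<m} (g i) (g i) = 1" if "i < n" for i
    using x(2) [of "n - 1 - i"] that by (simp add: ip_self g_def)
  have g0: "ip {..<m} (g i) (g j) = 0" if "i < j" "j < n" for i j
  proof -
    \<comment> \<open>Moved across, the adjoint pushes \<open>g j\<close> beyond the last index,
      since \<open>j + (n - 1 - i) \<ge> n\<close>.\<close>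
    have "ip {..<m} (g i) (g j) = ip {..<m} x (?T' (n - 1 - i) (g j))"
      unfolding g_def [of i] by (rule ip_mv_adj) simp_all
    also have "\<dots> = ip {..<m} x (\<lambda>s. 0)"
      using that by (intro ip_cong) (auto simp: T')
    finally show ?thesis by (simp add: ip_def)
  qed
  have "orthonormal {..<m} n g"
    unfolding orthonormal_def
  proof (intro allI impI)
    fix i j assume ij: "i < n" "j < n"
    consider "i = j" | "i < j" | "j < i" by linarith
    then show "ip {..<m} (g i) (g j) = (if i = j then 1 else 0)"
    proof cases
      case 1
      then show ?thesis using g1 ij by simp
    next
      case 2
      then show ?thesis using g0 ij by simp
    next
      case 3
      then show ?thesis using g0 [of j i] ij by (simp add: ip_cnj [of _ "g i" "g j"])
    qed
  qed
  with T T' show ?thesis by blast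
qed

text \<open>This is \<open>V* A V\<close> for the matrix \<open>V\<close> with columns
  \<open>v 0, ..., v (d - 1)\<close>.\<close>

definition compression :: "nat \<Rightarrow> nat \<Rightarrow> (nat \<Rightarrow> nat \<Rightarrow> complex) \<Rightarrow> complex mat \<Rightarrow> complex mat" where
  "compression d m v A = mat d d (\<lambda>(i,j). ip {..<m} (mv {..<m} (\<lambda>s t. A $$ (s,t)) (v j)) (v i))"

lemma unital_linear_on_compression:
  fixes n m :: nat
  assumes lin: "unital_linear_on n m \<phi>" and v: "orthonormal {..<m} d v"
  shows "unital_linear_on n d (\<lambda>X. compression d m v (\<phi> X))"
  unfolding unital_linear_on_def
proof (intro conjI ballI allI)
  fix X assume X: "X \<in> toeplitz_alg n"
  note cX = carrier_matD [OF unital_linear_onD(1) [OF lin X]]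
  show "compression d m v (\<phi> X) \<in> carrier_mat d d" by (simp add: compression_def)
  show "compression d m v (\<phi> (c \<cdot>\<^sub>m X)) = c \<cdot>\<^sub>m compression d m v (\<phi> X)" for c
  proof -
    have "mv {..<m} (\<lambda>s t. (c \<cdot>\<^sub>m \<phi> X) $$ (s,t)) u s = c * mv {..<m} (\<lambda>s t. \<phi> X $$ (s,t)) u s"
      if "s \<in> {..<m}" for u s
      using that by (simp add: mv_def cX sum_distrib_left mult.assoc)
    then have "ip {..<m} (mv {..<m} (\<lambda>s t. (c \<cdot>\<^sub>m \<phi> X) $$ (s,t)) u) z
        = c * ip {..<m} (mv {..<m} (\<lambda>s t. \<phi> X $$ (s,t)) u) z" for u z
      unfolding ip_scale_left [symmetric] by (rule ip_cong) simp_all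
    then show ?thesis
      by (intro eq_matI) (simp_all add: compression_def unital_linear_onD(3) [OF lin X])
  qed
  fix Y assume Y: "Y \<in> toeplitz_alg n"
  note cY = carrier_matD [OF unital_linear_onD(1) [OF lin Y]]
  show "compression d m v (\<phi> (X + Y)) = compression d m v (\<phi> X) + compression d m v (\<phi> Y)"
  proof -
    have "mv {..<m} (\<lambda>s t. (\<phi> X + \<phi> Y) $$ (s,t)) u s
        = mv {..<m} (\<lambda>s t. \<phi> X $$ (s,t)) u s + mv {..<m} (\<lambda>s t. \<phi> Y $$ (s,t)) u s"
      if "s \<in> {..<m}" for u s
      using that by (simp add: mv_def cX cY sum.distrib distrib_right)
    then have "ip {..<m} (mv {..<m} (\<lambda>s t. (\<phi> X + \<phi> Y) $$ (s,t)) u) z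
        = ip {..<m} (mv {..<m} (\<lambda>s t. \<phi> X $$ (s,t)) u) z + ip {..<m} (mv {..<m} (\<lambda>s t. \<phi> Y $$ (s,t)) u) z"
      for u z
      unfolding ip_add_left [symmetric] by (rule ip_cong) simp_all
    then show ?thesis
      by (intro eq_matI) (simp_all add: compression_def unital_linear_onD(2) [OF lin X Y])
  qed
next
  have one: "mv {..<m} (\<lambda>s t. (1\<^sub>m m :: complex mat) $$ (s,t)) u s = u s" if "s < m" for u s
  proof -
    have "mv {..<m} (\<lambda>s t. (1\<^sub>m m :: complex mat) $$ (s,t)) u s = (\<Sum>t<m. if t = s then u t else 0)"
      unfolding mv_def using that by (intro sum.cong) auto
    then show ?thesis using that by simp
  qed
  have "ip {..<m} (mv {..<m} (\<lambda>s t. (1\<^sub>m m :: complex mat) $$ (s,t)) u) w = ip {..<m} u w" for u w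
    by (rule ip_cong) (simp_all add: one)
  then show "compression d m v (\<phi> (1\<^sub>m n)) = 1\<^sub>m d"
    unfolding unital_linear_onD(4) [OF lin]
    by (intro eq_matI) (use v in \<open>auto simp: compression_def orthonormal_def\<close>)
qed

text \<open>Extend the family to an orthonormal basis and drop terms from Parseval's
  identity.\<close>

lemma bessel:
  fixes d m :: nat
  assumes v: "orthonormal {..<m} d v"
  shows "nsq {..<d} (\<lambda>i. ip {..<m} u (v i)) \<le> nsq {..<m} u"
proof -
  have d: "d \<le> m" using v by (rule orthonormal_card_le)
  obtain w where w: "orthonormal {..<m} m w" "\<forall>i<d. w i = v i"
    using orthonormal_extend [OF v d] by blast
  have "nsq {..<d} (\<lambda>i. ip {..<m} u (v i)) = (\<Sum>i<d. (cmod (ip {..<m} u (w i)))\<^sup>2)"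
    using w(2) by (simp add: nsq_def)
  also have "\<dots> \<le> (\<Sum>i<m. (cmod (ip {..<m} u (w i)))\<^sup>2)"
    using d by (intro sum_mono2) auto
  finally show ?thesis by (simp add: parseval [OF w(1)])
qed

text \<open>Compressing every block multiplies by a direct sum of \<open>k\<close> copies of an
  isometry on the right and by its adjoint, a contraction by Bessel, on the left.\<close>

lemma op_norm_block_compression_le:
  fixes d m k :: nat
  assumes v: "orthonormal {..<m} d v"
  shows "op_norm (block_mat k d d (\<lambda>a b. compression d m v (A a b))) \<le> op_norm (block_mat k m m A)"
proof -
  let ?c = "op_norm (block_mat k m m A)"
  have c: "0 \<le> ?c" by (rule op_norm_nonneg [OF block_mat_carrier])
  have bnd: "nsq ({..<k} \<times> {..<m}) (mv ({..<k} \<times> {..<m}) (blk A) y) \<le> ?c\<^sup>2 * nsq ({..<k} \<times> {..<m}) y" for y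
    using op_norm_block_le_iff [OF c, of k m m A] by simp
  show ?thesis
    unfolding op_norm_block_le_iff [OF c]
  proof
    fix x :: "nat \<times> nat \<Rightarrow> complex"
    \<comment> \<open>The image of \<open>x\<close> under that isometry.\<close>
    define y where "y p = (\<Sum>j<d. x (fst p, j) * v j (snd p))" for p :: "nat \<times> nat"
    have ny: "nsq ({..<k} \<times> {..<m}) y = nsq ({..<k} \<times> {..<d}) x"
      unfolding nsq_Times y_def fst_conv snd_conv nsq_orthonormal_combination [OF v] ..
    have eq: "mv ({..<k} \<times> {..<d}) (blk (\<lambda>a b. compression d m v (A a b))) x (a,i)
        = ip {..<m} (\<lambda>s. mv ({..<k} \<times> {..<m}) (blk A) y (a,s)) (v i)" if "i < d" for a i
    proof -
      have "mv ({..<k} \<times> {..<d}) (blk (\<lambda>a b. compression d m v (A a b))) x (a,i)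
          = (\<Sum>b<k. \<Sum>j<d. x (b,j) * ip {..<m} (mv {..<m} (\<lambda>s t. A a b $$ (s,t)) (v j)) (v i))"
        unfolding mv_blk mv_def [of "{..<d}"] using that
        by (intro sum.cong refl) (simp add: compression_def mult.commute)
      also have "\<dots> = (\<Sum>b<k. 1 * ip {..<m} (mv {..<m} (\<lambda>s t. A a b $$ (s,t)) (\<lambda>t. y (b,t))) (v i))"
        unfolding y_def fst_conv snd_conv mv_sum [abs_def] ip_sum_left by simp
      also have "\<dots> = ip {..<m} (\<lambda>s. mv ({..<k} \<times> {..<m}) (blk A) y (a,s)) (v i)"
        unfolding ip_sum_left [symmetric] mv_blk by simp
      finally show ?thesis .
    qed
    have "nsq ({..<k} \<times> {..<d}) (mv ({..<k} \<times> {..<d}) (blk (\<lambda>a b. compression d m v (A a b))) x)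
        = (\<Sum>a<k. nsq {..<d} (\<lambda>i. ip {..<m} (\<lambda>s. mv ({..<k} \<times> {..<m}) (blk A) y (a,s)) (v i)))"
      unfolding nsq_Times by (intro sum.cong refl nsq_cong) (simp add: eq)
    also have "\<dots> \<le> nsq ({..<k} \<times> {..<m}) (mv ({..<k} \<times> {..<m}) (blk A) y)"
      unfolding nsq_Times by (intro sum_mono bessel [OF v])
    also have "\<dots> \<le> ?c\<^sup>2 * nsq ({..<k} \<times> {..<m}) y" by (rule bnd)
    finally show "nsq ({..<k} \<times> {..<d}) (mv ({..<k} \<times> {..<d}) (blk (\<lambda>a b. compression d m v (A a b))) x)
        \<le> ?c\<^sup>2 * nsq ({..<k} \<times> {..<d}) x" by (simp only: ny)
  qed
qed

section \<open>The unitary equivalence\<close>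

lemma copies_mat_1: "X \<in> carrier_mat n n \<Longrightarrow> copies_mat (Suc 0) X = X"
  by (rule eq_matI) (auto simp: copies_mat_def block_mat_def)

lemma mat_adjoint_frame: "mat_adjoint (mat m m (\<lambda>(s,i). w i s)) = mat m m (\<lambda>(i,s). cnj (w i s :: complex))"
  by (rule eq_matI) (auto simp: mat_adjoint_def mat_of_rows_index)

theorem theorem6p2:
  fixes n m :: nat and \<phi> :: "complex mat \<Rightarrow> complex mat"
  assumes "n \<ge> 1"
    and "unital_linear_on n m \<phi>"
    and "completely_isometric_on n m \<phi>"
  shows "n \<le> m \<and>
    (\<exists>U l \<psi>. U \<in> carrier_mat m m \<and> unitary_mat U \<and> l > 0 \<and> l * n \<le> m \<and>
       unital_linear_on n (m - l * n) \<psi> \<and> completely_contractive_on n (m - l * n) \<psi> \<and>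
       (\<forall>X\<in>toeplitz_alg n. \<phi> X = U * dsum_mat (copies_mat l X) (\<psi> X) * mat_adjoint U))"
proof -
  note lin = assms(2) and iso = assms(3)
  obtain g where g: "orthonormal {..<m} n g"
    and Tg: "\<And>i k s. i < n \<Longrightarrow> s < m \<Longrightarrow> mv {..<m} (shift_im \<phi> n k) (g i) s = (if k \<le> i then g (i - k) s else 0)"
    and T'g: "\<And>i k s. i < n \<Longrightarrow> s < m \<Longrightarrow>
      mv {..<m} (adj (shift_im \<phi> n k)) (g i) s = (if i + k < n then g (i + k) s else 0)"
    using exists_shift_frame [OF lin iso assms(1)] by blast
  have nm: "n \<le> m" using g by (rule orthonormal_card_le)
  obtain w where w: "orthonormal {..<m} m w" and wg: "\<And>i. i < n \<Longrightarrow> w i = g i"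
    using orthonormal_extend [OF g nm] by blast
  define U where "U = mat m m (\<lambda>(s,i). w i s)"
  define V where "V = mat m m (\<lambda>(i,s). cnj (w i s))"
  have UV: "U \<in> carrier_mat m m" "V \<in> carrier_mat m m" by (simp_all add: U_def V_def)
  have adjU: "mat_adjoint U = V" unfolding U_def V_def by (rule mat_adjoint_frame)
  have VU1: "V * U = 1\<^sub>m m" unfolding U_def V_def by (rule adjoint_frame_product [OF w])
  have UV1: "U * V = 1\<^sub>m m" by (rule mat_mult_left_right_inverse [OF UV(2,1) VU1])
  have unitary: "unitary_mat U"
    using UV UV1 VU1 by (simp add: unitary_mat_def adjU)
  \<comment> \<open>The remaining basis vectors span the orthogonal complement of the frame, on
    which \<open>\<psi>\<close> lives.\<close>
  define v where "v i = w (i + n)" for i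
  have v: "orthonormal {..<m} (m - n) v"
    using w by (auto simp: orthonormal_def v_def)
  define \<psi> where "\<psi> X = compression (m - n) m v (\<phi> X)" for X
  have \<psi>lin: "unital_linear_on n (m - n) \<psi>"
    unfolding \<psi>_def by (rule unital_linear_on_compression [OF lin v])
  have \<psi>cc: "completely_contractive_on n (m - n) \<psi>"
    unfolding completely_contractive_on_def
  proof (intro allI impI)
    fix k :: nat and F assume F: "\<forall>a<k. \<forall>b<k. F a b \<in> toeplitz_alg n"
    have "op_norm (block_mat k (m - n) (m - n) (\<lambda>a b. \<psi> (F a b))) \<le> op_norm (block_mat k m m (\<lambda>a b. \<phi> (F a b)))"
      unfolding \<psi>_def by (rule op_norm_block_compression_le [OF v])
    also have "\<dots> = op_norm (block_mat k n n F)"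
      using iso F by (simp add: completely_isometric_on_def)
    finally show "op_norm (block_mat k (m - n) (m - n) (\<lambda>a b. \<psi> (F a b))) \<le> op_norm (block_mat k n n F)" .
  qed
  \<comment> \<open>All entries outside the lower right block. For \<open>j < n\<close> the frame is
    invariant under the images; for \<open>j \<ge> n\<close> and \<open>i < n\<close> its invariance
    under the adjoints kills the upper right block.\<close>
  have Tw: "ip {..<m} (mv {..<m} (shift_im \<phi> n k) (w j)) (w i) = (if i < n \<and> j < n \<and> j = i + k then 1 else 0)"
    if ij: "i < m" "j < m" "i < n \<or> j < n" for i j k
  proof (cases "j < n")
    case True
    have "ip {..<m} (mv {..<m} (shift_im \<phi> n k) (w j)) (w i)
        = ip {..<m} (\<lambda>s. if k \<le> j then w (j - k) s else 0) (w i)"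
      using True by (intro ip_cong) (auto simp: wg Tg)
    also have "\<dots> = (if k \<le> j then (if j - k = i then 1 else 0) else 0)"
      using ij orthonormalD [OF w, of "j - k" i] by (simp add: ip_def)
    finally show ?thesis using True by auto
  next
    case False
    have "ip {..<m} (mv {..<m} (shift_im \<phi> n k) (w j)) (w i)
        = ip {..<m} (w j) (mv {..<m} (adj (shift_im \<phi> n k)) (w i))"
      by (rule ip_mv_adj) simp_all
    also have "\<dots> = ip {..<m} (w j) (\<lambda>s. if i + k < n then w (i + k) s else 0)"
      using False ij by (intro ip_cong) (auto simp: wg T'g)
    also have "\<dots> = 0"
      using False ij nm orthonormalD [OF w, of j "i + k"] by (cases "i + k < n") (simp_all add: ip_def)
    finally show ?thesis using False by simp
  qed
  have "\<phi> X = U * dsum_mat (copies_mat 1 X) (\<psi> X) * mat_adjoint U" if X: "X \<in> toeplitz_alg n" for X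
  proof -
    obtain c where c: "X = toep n c" using X by (auto simp: toeplitz_alg_eq)
    have car: "\<phi> X \<in> carrier_mat m m" by (rule unital_linear_onD(1) [OF lin X])
    \<comment> \<open>The entries of \<open>\<phi> X\<close> in the basis \<open>w\<close>, that is,
      of \<open>V * \<phi> X * U\<close>.\<close>
    let ?E = "\<lambda>i j. ip {..<m} (mv {..<m} (\<lambda>s t. \<phi> X $$ (s,t)) (w j)) (w i)"
    have E: "?E i j = (if i < n \<and> j < n then X $$ (i,j) else 0)" if ij: "i < m" "j < m" "i < n \<or> j < n" for i j
    proof -
      have "?E i j = ip {..<m} (\<lambda>s. \<Sum>k<n. c k * mv {..<m} (shift_im \<phi> n k) (w j) s) (w i)"
      proof (rule ip_cong)
        fix s assume "s \<in> {..<m}"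
        then have "mv {..<m} (\<lambda>s t. \<phi> X $$ (s,t)) (w j) s
            = (\<Sum>t<m. \<Sum>k<n. c k * shift_im \<phi> n k s t * w j t)"
          by (simp add: mv_def c unital_linear_on_toep [OF lin] shift_im_def sum_distrib_right)
        also have "\<dots> = (\<Sum>k<n. c k * mv {..<m} (shift_im \<phi> n k) (w j) s)"
          by (subst sum.swap) (simp add: mv_def sum_distrib_left mult.assoc)
        finally show "mv {..<m} (\<lambda>s t. \<phi> X $$ (s,t)) (w j) s
            = (\<Sum>k<n. c k * mv {..<m} (shift_im \<phi> n k) (w j) s)" .
      qed simp
      also have "\<dots> = (\<Sum>k<n. c k * (if i < n \<and> j < n \<and> j = i + k then 1 else 0))"
        unfolding ip_sum_left by (simp add: Tw [OF ij])
      \<comment> \<open>The guard \<open>i \<le> j\<close> compensates for truncated subtraction in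
        \<open>j - i\<close>.\<close>
      also have "\<dots> = (\<Sum>k<n. if k = j - i then (if i < n \<and> j < n \<and> i \<le> j then c k else 0) else 0)"
        by (intro sum.cong) auto
      also have "\<dots> = (if i < n \<and> j < n then X $$ (i,j) else 0)"
        by (auto simp: c toep_def)
      finally show ?thesis .
    qed
    have Xc: "X \<in> carrier_mat n n" by (simp add: c)
    have "dsum_mat (copies_mat 1 X) (\<psi> X) = V * \<phi> X * U"
    proof (rule eq_matI)
      fix i j assume "i < dim_row (V * \<phi> X * U)" "j < dim_col (V * \<phi> X * U)"
      then have ij: "i < m" "j < m" by (simp_all add: U_def V_def)
      have "V * \<phi> X * U = V * (\<phi> X * U)" using UV car by (simp add: assoc_mult_mat)
      then have "(V * \<phi> X * U) $$ (i,j) = ?E i j"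
        using ij car unfolding ip_def mv_def
        by (simp add: U_def V_def scalar_prod_def lessThan_atLeast0 mult.commute)
      moreover have "dsum_mat (copies_mat 1 X) (\<psi> X) $$ (i,j) = ?E i j"
      proof (cases "i < n \<or> j < n")
        case True
        then show ?thesis
          using E [OF ij True] ij Xc nm
          by (auto simp: dsum_mat_def copies_mat_1 [OF Xc] \<psi>_def compression_def)
      next
        case False
        then have "i - n < m - n" "j - n < m - n" "i - n + n = i" "j - n + n = j" using ij by auto
        with False show ?thesis
          using ij Xc
          by (simp add: dsum_mat_def copies_mat_1 [OF Xc] \<psi>_def compression_def v_def)
      qed
      ultimately show "dsum_mat (copies_mat 1 X) (\<psi> X) $$ (i,j) = (V * \<phi> X * U) $$ (i,j)" by simp
    qed (use nm Xc in \<open>simp_all add: dsum_mat_def copies_mat_1 [OF Xc] \<psi>_def compression_def U_def V_def\<close>)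
    moreover have "U * (V * \<phi> X * U) * V = (U * V) * \<phi> X * (U * V)"
      using UV car by (simp add: assoc_mult_mat [of _ m m _ m _ m] mult_carrier_mat [of _ m m _ m])
    ultimately show ?thesis using car by (simp add: adjU UV1)
  qed
  then show ?thesis
    using nm UV(1) unitary \<psi>lin \<psi>cc by (intro conjI exI [of _ U] exI [of _ 1] exI [of _ \<psi>]) auto
qed

end
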